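(* Let $\beta>0$, $\varepsilon\in(0,1/2]$, $p=\tfrac12+\varepsilon$, and let $(G_n)_{n\ge0}$ be the DRGVR with parameters $\beta,\varepsilon$. There is a sequence $(\hat\delta_n)_{n\ge1}$ tending to $0$ and such that $G_{BD}(1-\hat\delta_n,n)$, $G_n$ and $G_{BD}(1+\hat\delta_n,n)$ can be coupled so that, with high probability, $$G_{BD}(1-\hat\delta_n,n)\subseteq G_n\subseteq G_{BD}(1+\hat\delta_n,n).$$
   Context: **DRGVR (Dynamic Random Graph with Vertex Removal).** Let $\beta>0$, $\varepsilon\in(0,1/2]$, $p=\tfrac12+\varepsilon$, and let $(\xi_n)$ be i.i.d. Bernoulli($p$). $G_0$ is the empty graph. For $n\ge1$, $G_n=(V_n,E_n)$ is built from $G_{n-1}=(V_{n-1},E_{n-1})$: if $\xi_n=1$, then $V_n=V_{n-1}\cup\{n\}$ and, conditionally on $V_{n-1}$, $E_n$ is obtained from $E_{n-1}$ by adding each edge $\{i,n\}$, $i\in V_{n-1}$, independently with probability $\min\{\beta/|V_{n-1}|,1\}$ (no edge is added if $V_{n-1}=\emptyset$); if $\xi_n=0$, a uniformly random vertex of $V_{n-1}$ (if any) is removed together with all its incident edges. **Birth-death inhomogeneous Erdős–Rényi graph.** For a constant $\Delta>0$ and an integer $n$, $G_{BD}(\Delta,n)$ has vertex set $V_n$ (the vertex set of $G_n$, on which one conditions) and, for all $1\le i<j\le|V_n|$, the edge between the $i$-th and the $j$-th vertex of $V_n$ (in increasing order of labels) is sampled independently of other edges with probability $$p_{ij}=p_{ij}(\Delta)=\Delta\beta(2\varepsilon)^{-(1-p)/p}\,\frac1n\Big(\frac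 jn\Big)^{-2\varepsilon/p}.$$ "With high probability" means with probability tending to $1$ as $n\to\infty$.
   Formalization: The endpoint ε=1/2 is excluded, since the claim fails there for every β>0: for fixed j≥β+2 the edge {1,j} has probability β/(j-1) in G_n but tends to β/j in G_BD(1+δ_n,n). *)

theory Defs
  imports "HOL-Probability.Probability"
begin

type_synonym graph = "nat set \<times> nat set set"

abbreviation vertices :: "graph \<Rightarrow> nat set" where "vertices \<equiv> fst"
abbreviation edges :: "graph \<Rightarrow> nat set set" where "edges \<equiv> snd"

definition subgraph :: "graph \<Rightarrow> graph \<Rightarrow> bool" (infix "\<subseteq>\<^sub>G" 50) where
  "G \<subseteq>\<^sub>G H \<longleftrightarrow> vertices G \<subseteq> vertices H \<and> edges G \<subseteq> edges H"

text \<open>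
  The random subset of a finite set \<open>C\<close> that contains each \<open>e \<in> C\<close>
  independently with probability \<open>q e\<close>.
\<close>

definition random_subset :: "'a set \<Rightarrow> ('a \<Rightarrow> real) \<Rightarrow> 'a set pmf" where
  "random_subset C q =
     map_pmf (\<lambda>b. {e \<in> C. b e}) (Pi_pmf C False (\<lambda>e. bernoulli_pmf (q e)))"

definition birth_prob :: "real \<Rightarrow> real" where
  "birth_prob \<epsilon> = 1 / 2 + \<epsilon>"

text \<open>
  In \<open>add_vertex\<close>, if \<open>V = {}\<close> there is no candidate edge, so the value of
  \<open>\<beta> / real (card V)\<close> is irrelevant.
\<close>

definition add_vertex :: "real \<Rightarrow> nat \<Rightarrow> graph \<Rightarrow> graph pmf" where
  "add_vertex \<beta> n = (\<lambda>(V, E).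
     map_pmf (\<lambda>F. (insert n V, E \<union> F))
       (random_subset ((\<lambda>i. {i, n}) ` V) (\<lambda>_. min (\<beta> / real (card V)) 1)))"

definition remove_vertex :: "graph \<Rightarrow> graph pmf" where
  "remove_vertex = (\<lambda>(V, E).
     if V = {} then return_pmf (V, E)
     else map_pmf (\<lambda>v. (V - {v}, {e \<in> E. v \<notin> e})) (pmf_of_set V))"

definition drgvr_step :: "real \<Rightarrow> real \<Rightarrow> nat \<Rightarrow> graph \<Rightarrow> graph pmf" where
  "drgvr_step \<beta> \<epsilon> n G =
     bind_pmf (bernoulli_pmf (birth_prob \<epsilon>))
       (\<lambda>\<xi>. if \<xi> then add_vertex \<beta> n G else remove_vertex G)"

text \<open>
  The law of \<open>G\<^sub>n\<close>. Since the \<open>\<xi>\<^sub>n\<close> are i.i.d. and all other choices at step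
  \<open>n\<close> depend only on \<open>G\<^sub>n\<^sub>-\<^sub>1\<close>, the process is a time-inhomogeneous Markov chain.
\<close>

primrec drgvr :: "real \<Rightarrow> real \<Rightarrow> nat \<Rightarrow> graph pmf" where
  "drgvr \<beta> \<epsilon> 0 = return_pmf ({}, {})"
| "drgvr \<beta> \<epsilon> (Suc n) = bind_pmf (drgvr \<beta> \<epsilon> n) (drgvr_step \<beta> \<epsilon> (Suc n))"

text \<open>
  For \<open>\<epsilon> = 1 / 2\<close> no vertex is ever removed, and this probability is \<open>\<Delta> * \<beta> / j\<close>,
  whereas vertex \<open>j\<close> of \<open>G\<^sub>n\<close> is joined to each earlier vertex with probability
  \<open>\<beta> / (j - 1)\<close> (for \<open>j \<ge> \<beta> + 1\<close>). For fixed \<open>j\<close> these stay apart as \<open>n \<rightarrow> \<infinity>\<close> and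
  \<open>\<Delta> \<rightarrow> 1\<close>, so \<open>G\<^sub>n\<close> is then not asymptotically contained in \<open>G\<^sub>B\<^sub>D(1 + \<delta>\<^sub>n, n)\<close>.
\<close>

definition bd_prob :: "real \<Rightarrow> real \<Rightarrow> real \<Rightarrow> nat \<Rightarrow> nat \<Rightarrow> real" where
  "bd_prob \<beta> \<epsilon> \<Delta> n j = (let p = birth_prob \<epsilon> in
     \<Delta> * \<beta> * (2 * \<epsilon>) powr (- ((1 - p) / p)) * (1 / real n)
       * (real j / real n) powr (- (2 * \<epsilon> / p)))"

definition vertex_index :: "nat set \<Rightarrow> nat \<Rightarrow> nat" where
  "vertex_index V v = card {u \<in> V. u \<le> v}"

text \<open>
  \<open>bd_given\<close> is the conditional law of \<open>G\<^sub>B\<^sub>D(\<Delta>, n)\<close> given that the vertex set is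
  \<open>V\<close>. The vertex with \<open>vertex_index V v = j\<close> is the \<open>j\<close>-th vertex of \<open>V\<close>
  (counted from 1), so for an edge \<open>e\<close> the larger of its two indices is that of
  \<open>Max e\<close>. The truncation at 1 is needed because \<open>bd_prob\<close> may exceed 1.
\<close>

definition bd_given :: "real \<Rightarrow> real \<Rightarrow> real \<Rightarrow> nat \<Rightarrow> nat set \<Rightarrow> graph pmf" where
  "bd_given \<beta> \<epsilon> \<Delta> n V =
     map_pmf (\<lambda>F. (V, F))
       (random_subset {{u, v} | u v. u \<in> V \<and> v \<in> V \<and> u < v}
          (\<lambda>e. min (bd_prob \<beta> \<epsilon> \<Delta> n (vertex_index V (Max e))) 1))"

definition bd_graph :: "real \<Rightarrow> real \<Rightarrow> real \<Rightarrow> nat \<Rightarrow> graph pmf" where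
  "bd_graph \<beta> \<epsilon> \<Delta> n =
     bind_pmf (map_pmf vertices (drgvr \<beta> \<epsilon> n)) (bd_given \<beta> \<epsilon> \<Delta> n)"

text \<open>
  A coupling of \<open>G\<^sub>B\<^sub>D(\<Delta>\<^sub>1, n)\<close>, \<open>G\<^sub>n\<close> and \<open>G\<^sub>B\<^sub>D(\<Delta>\<^sub>2, n)\<close>. All three graphs have the
  same random vertex set \<open>V\<^sub>n\<close>; together with the marginals this says that, given
  \<open>V\<^sub>n\<close>, the outer two have the laws \<open>bd_given\<close>.
\<close>

definition bd_drgvr_coupling ::
    "real \<Rightarrow> real \<Rightarrow> nat \<Rightarrow> real \<Rightarrow> real \<Rightarrow> (graph \<times> graph \<times> graph) pmf \<Rightarrow> bool" where
  "bd_drgvr_coupling \<beta> \<epsilon> n \<Delta>\<^sub>1 \<Delta>\<^sub>2 M \<longleftrightarrow>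
     map_pmf (\<lambda>(A, G, B). A) M = bd_graph \<beta> \<epsilon> \<Delta>\<^sub>1 n \<and>
     map_pmf (\<lambda>(A, G, B). G) M = drgvr \<beta> \<epsilon> n \<and>
     map_pmf (\<lambda>(A, G, B). B) M = bd_graph \<beta> \<epsilon> \<Delta>\<^sub>2 n \<and>
     (AE (A, G, B) in measure_pmf M. vertices A = vertices G \<and> vertices B = vertices G)"

end

theory Submission
  imports Defs "HOL-Real_Asymp.Real_Asymp"
begin

text \<open>
  Given the sequence of births and the set \<open>V\<^sub>n\<close>, the edges of \<open>G\<^sub>n\<close> are independent,
  and an edge whose larger end is \<open>j\<close> is present with probability
  \<open>min (\<beta> / \<bar>V\<^bsub>j-1\<^esub>\<bar>) 1\<close>. Hence the three graphs can be coupled edge by edge, and a single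
  edge violates the inclusions only if its three probabilities are not in increasing order.
  Hoeffding's inequality gives \<open>\<bar>V\<^bsub>i\<^esub>\<bar> = 2 * \<epsilon> * i + O(i powr (3 / 4))\<close>. Given the births, the number
  of survivors with label at most \<open>s\<close> has variance at most its mean, and this mean is close to
  \<open>2 * \<epsilon> * n * (s / n) powr (p / (2 * \<epsilon>))\<close>. By Chebyshev's inequality on a grid, the position in \<open>V\<^sub>n\<close> of
  every vertex that is not too old is close to this value, which turns \<open>\<beta> / \<bar>V\<^bsub>j-1\<^esub>\<bar>\<close> into \<open>bd_prob\<close>
  up to a factor \<open>1 \<plusminus> \<delta>\<close>. The few very old survivors span no edge whp, and
  letting \<open>\<delta>\<close> tend to \<open>0\<close> slowly gives the sequence.
\<close>

section \<open>The coupling\<close>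

subsection \<open>Probability mass functions\<close>

text \<open>A vertex alive at time i - 1 is removed at step i with probability about (1 - p) /
  (2\<epsilon> i). Of the roughly 2\<epsilon> s vertices alive at time s, a fraction of about (s /
  n)^((1 - p) / (2\<epsilon>)) is therefore left at time n. This is the origin of the exponent a = p
  / (2\<epsilon>) = 1 + (1 - p) / (2\<epsilon>). Label j thus sits at position k \<approx>
  2\<epsilon> n (j / n)^a of V_n, and solving for j turns \<beta> / (2\<epsilon> j) into the formula
  for G_BD, with its exponent -1 / a and its constant. The obstacle is that a count of survivors
  concentrates only if its mean is large, which fails for labels up to about n^(1 - 1/a). For
  \<epsilon> < 1/2 one has a > 1, so this range ends at a positive power of n. Labels up to a
  smaller power of n have then died out whp, the remaining edges have probabilities that are
  polynomially small in n, and there is room to extend the bad range until concentration holds while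
  its survivors still span few enough pairs. For \<epsilon> = 1/2 one has a = 1 and the first
  vertices stay.\<close>

lemma expectation_bind_pmf_finite:
  fixes h :: "'b \<Rightarrow> real"
  assumes "finite (set_pmf p)" "\<And>x. x \<in> set_pmf p \<Longrightarrow> finite (set_pmf (f x))"
  shows "measure_pmf.expectation (bind_pmf p f) h =
    measure_pmf.expectation p (\<lambda>x. measure_pmf.expectation (f x) h)"
proof -
  have "measure_pmf.expectation p (\<lambda>x. measure_pmf.expectation (f x) h) =
    (\<Sum>a\<in>set_pmf p. pmf p a *\<^sub>R measure_pmf.expectation (f a) h)"
    using assms by (subst integral_measure_pmf[of "set_pmf p"]) (auto simp: mult.commute)
  with assms show ?thesis
    by (subst pmf_expectation_bind[of "set_pmf p"]) auto
qed

text \<open>Off the good set \<open>A\<close> the conditional probability is bounded by 1. The lemma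
  is applied to the births and then to the survivors, so that the probabilities of the bad events
  simply add up.\<close>

lemma prob_bind_pmf_le:
  assumes "\<And>x. x \<in> set_pmf p \<Longrightarrow> x \<in> A \<Longrightarrow> measure_pmf.prob (f x) X \<le> a" and "a \<ge> 0"
  shows "measure_pmf.prob (bind_pmf p f) X \<le> a + measure_pmf.prob p (- A)"
proof -
  have "emeasure (bind_pmf p f) X = (\<integral>\<^sup>+x. emeasure (f x) X \<partial>p)"
    by simp
  also have "\<dots> \<le> (\<integral>\<^sup>+x. ennreal a + indicator (- A) x \<partial>p)"
  proof (intro nn_integral_mono_AE, subst AE_measure_pmf_iff, intro ballI)
    fix x assume x: "x \<in> set_pmf p"
    show "emeasure (f x) X \<le> ennreal a + indicator (- A) x"
    proof (cases "x \<in> A")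
      case True
      with assms(1)[OF x] show ?thesis
        by (simp add: measure_pmf.emeasure_eq_measure ennreal_leI)
    next
      case False
      have "emeasure (f x) X \<le> 1" by (rule measure_pmf.emeasure_le_1)
      also have "1 \<le> ennreal a + 1" by simp
      finally show ?thesis using False by simp
    qed
  qed
  also have "\<dots> = ennreal a + emeasure p (- A)"
    by (subst nn_integral_add) auto
  also have "\<dots> = ennreal (a + measure_pmf.prob p (- A))"
    using assms(2) by (simp add: measure_pmf.emeasure_eq_measure)
  finally have "ennreal (measure_pmf.prob (bind_pmf p f) X) \<le> ennreal (a + measure_pmf.prob p (- A))"
    unfolding measure_pmf.emeasure_eq_measure .
  then show ?thesis
    using assms(2) by (subst (asm) ennreal_le_iff) auto
qed

lemma pmf_bool_eqI:
  assumes "pmf p True = pmf q True"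
  shows "p = q"
proof (rule pmf_eqI)
  fix b
  have "pmf r False = 1 - pmf r True" for r :: "bool pmf"
    using sum_pmf_eq_1[OF finite subset_UNIV, of r] by (simp add: UNIV_bool)
  with assms show "pmf p b = pmf q b" by (cases b) auto
qed

lemma bernoulli_pmf_thinning:
  assumes "0 \<le> b" "b \<le> c" "c \<le> 1"
  shows "bind_pmf (bernoulli_pmf c) (\<lambda>z. map_pmf (\<lambda>y. z \<and> y) (bernoulli_pmf (b / c))) = bernoulli_pmf b"
proof (rule pmf_bool_eqI)
  \<comment> \<open>If \<open>c = 0\<close>, then also \<open>b = 0\<close>, and
    \<open>b / c = 0\<close>.\<close>
  have "0 \<le> b / c" "b / c \<le> 1" "c * (b / c) = b"
    using assms by (auto simp: divide_le_eq)
  moreover have "pmf (map_pmf (\<lambda>y. z \<and> y) r) True = (if z then pmf r True else 0)"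
    for z and r :: "bool pmf"
    by (cases z) (auto simp: map_pmf_const pmf_eq_0_set_pmf)
  ultimately show "pmf (bind_pmf (bernoulli_pmf c) (\<lambda>z. map_pmf (\<lambda>y. z \<and> y) (bernoulli_pmf (b / c)))) True =
      pmf (bernoulli_pmf b) True"
    using assms by (simp add: pmf_bind mult.commute)
qed

subsection \<open>Random subsets\<close>

lemma random_subset_cong:
  assumes "C = D" "\<And>e. e \<in> D \<Longrightarrow> q e = r e"
  shows "random_subset C q = random_subset D r"
  unfolding random_subset_def using assms by (intro arg_cong2[where f = map_pmf] Pi_pmf_cong) auto

lemma random_subset_empty [simp]: "random_subset {} q = return_pmf {}"
  by (simp add: random_subset_def)

lemma set_pmf_random_subset: "set_pmf (random_subset C q) \<subseteq> Pow C"
  by (auto simp: random_subset_def)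

text \<open>The shape of a birth: the old candidate edges and the star at the new vertex are
  disjoint, hence sampled independently.\<close>

lemma random_subset_Un:
  assumes "finite C" "finite D" "C \<inter> D = {}"
  shows "random_subset (C \<union> D) q =
    bind_pmf (random_subset C q) (\<lambda>E. map_pmf (\<lambda>F. E \<union> F) (random_subset D q))"
proof -
  have eq: "{e \<in> C \<union> D. if e \<in> C then f e else g e} = {e \<in> C. f e} \<union> {e \<in> D. g e}" for f g
    using assms(3) by auto
  show ?thesis
    unfolding random_subset_def Pi_pmf_union[OF assms]
    by (simp add: pair_pmf_def map_pmf_def bind_assoc_pmf bind_return_pmf eq del: mem_Collect_eq Un_iff)
qed

text \<open>The shape of a removal: the edges that avoid the lost vertex keep their joint
  law.\<close>

lemma random_subset_Int:
  assumes "finite C" "D \<subseteq> C"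
  shows "map_pmf (\<lambda>E. E \<inter> D) (random_subset C q) = random_subset D q"
proof -
  have "Pi_pmf D False (\<lambda>e. bernoulli_pmf (q e)) =
    map_pmf (\<lambda>f x. if x \<in> D then f x else False) (Pi_pmf C False (\<lambda>e. bernoulli_pmf (q e)))"
    using assms by (rule Pi_pmf_subset)
  moreover have "{e \<in> C. f e} \<inter> D = {e \<in> D. if e \<in> D then f e else False}" for f
    using assms(2) by auto
  ultimately show ?thesis
    unfolding random_subset_def by (simp add: map_pmf_comp)
qed

definition pairs :: "nat set \<Rightarrow> nat set set" where
  "pairs V = {{u, v} | u v. u \<in> V \<and> v \<in> V \<and> u < v}"

lemma finite_pairs: "finite V \<Longrightarrow> finite (pairs V)"
  by (rule finite_subset[of _ "Pow V"]) (auto simp: pairs_def)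

lemma Max_pair: "(u::nat) < v \<Longrightarrow> Max {u, v} = v"
  by simp

lemma pairs_insert:
  assumes "\<And>v. v \<in> V \<Longrightarrow> v < m"
  shows "pairs (insert m V) = pairs V \<union> (\<lambda>i. {i, m}) ` V" (is "?L = ?R")
proof
  show "?L \<subseteq> ?R"
  proof
    fix e assume "e \<in> ?L"
    then obtain u v where e: "e = {u, v}" "u \<in> insert m V" "v \<in> insert m V" "u < v"
      by (auto simp: pairs_def)
    with assms have "u \<in> V" by (metis insertE less_asym less_irrefl)
    with e show "e \<in> ?R" by (auto simp: pairs_def)
  qed
  show "?R \<subseteq> ?L"
    using assms by (auto simp: pairs_def)
qed

lemma pairs_disjoint_star:
  assumes "\<And>v. v \<in> V \<Longrightarrow> v < (m::nat)"
  shows "pairs V \<inter> (\<lambda>i. {i, m}) ` V = {}"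
proof -
  have "m \<notin> e" if "e \<in> pairs V" for e
    using assms that by (auto simp: pairs_def)
  then show ?thesis by auto
qed

text \<open>Turns the deletion of edges into an intersection with a set that does not depend on
  \<open>E\<close>, so that \<open>random_subset_Int\<close> applies.\<close>

lemma pairs_remove:
  assumes "E \<subseteq> pairs V"
  shows "{e \<in> E. v \<notin> e} = E \<inter> pairs (V - {v})"
proof -
  have "v \<notin> e \<longleftrightarrow> e \<in> pairs (V - {v})" if "e \<in> pairs V" for e
  proof
    assume v: "v \<notin> e"
    from that obtain a b where "e = {a, b}" "a \<in> V" "b \<in> V" "a < b"
      by (auto simp: pairs_def)
    with v show "e \<in> pairs (V - {v})"
      unfolding pairs_def by blast
  qed (auto simp: pairs_def)
  with assms show ?thesis by auto
qed

subsection \<open>Disintegration of the process\<close>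

text \<open>Only the births up to time \<open>n\<close> are drawn: over a finite index set the
  product is discrete, and everything stays within \<open>pmf\<close>.\<close>

definition births :: "real \<Rightarrow> nat \<Rightarrow> (nat \<Rightarrow> bool) pmf" where
  "births \<epsilon> n = Pi_pmf {1..n} False (\<lambda>_. bernoulli_pmf (birth_prob \<epsilon>))"

primrec graph_given :: "real \<Rightarrow> (nat \<Rightarrow> bool) \<Rightarrow> nat \<Rightarrow> graph pmf" where
  "graph_given \<beta> \<xi> 0 = return_pmf ({}, {})"
| "graph_given \<beta> \<xi> (Suc n) = bind_pmf (graph_given \<beta> \<xi> n)
     (\<lambda>G. if \<xi> (Suc n) then add_vertex \<beta> (Suc n) G else remove_vertex G)"

text \<open>The vertex sets form a Markov chain of their own, because the removed vertex is uniform
  whatever the edges are.\<close>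

primrec vset :: "(nat \<Rightarrow> bool) \<Rightarrow> nat \<Rightarrow> nat set pmf" where
  "vset \<xi> 0 = return_pmf {}"
| "vset \<xi> (Suc n) = bind_pmf (vset \<xi> n) (\<lambda>V.
     if \<xi> (Suc n) then return_pmf (insert (Suc n) V)
     else if V = {} then return_pmf V else map_pmf (\<lambda>v. V - {v}) (pmf_of_set V))"

text \<open>Given the births, the population size is deterministic. Truncated subtraction models a
  removal step that finds no vertex.\<close>

primrec popsize :: "(nat \<Rightarrow> bool) \<Rightarrow> nat \<Rightarrow> nat" where
  "popsize \<xi> 0 = 0"
| "popsize \<xi> (Suc n) = (if \<xi> (Suc n) then popsize \<xi> n + 1 else popsize \<xi> n - 1)"

lemma graph_given_cong:
  assumes "\<And>i. i \<in> {1..n} \<Longrightarrow> \<xi> i = \<zeta> i"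
  shows "graph_given \<beta> \<xi> n = graph_given \<beta> \<zeta> n"
  using assms by (induction n) auto

text \<open>The coin of a step is independent of the graph before it, so all coins can be tossed in
  advance; the two exchanges below move the last coin to the front.\<close>

lemma drgvr_eq_bind_births: "drgvr \<beta> \<epsilon> n = bind_pmf (births \<epsilon> n) (\<lambda>\<xi>. graph_given \<beta> \<xi> n)"
proof (induction n)
  case 0
  then show ?case by (simp add: births_def bind_return_pmf)
next
  case (Suc n)
  let ?b = "bernoulli_pmf (birth_prob \<epsilon>)"
  have births: "births \<epsilon> (Suc n) =
      do {y \<leftarrow> ?b; \<xi> \<leftarrow> births \<epsilon> n; return_pmf (\<xi>(Suc n := y))}"
    unfolding births_def by (simp add: atLeastAtMostSuc_conv Pi_pmf_insert')
  have cong: "graph_given \<beta> (\<xi>(Suc n := y)) n = graph_given \<beta> \<xi> n" for \<xi> y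
    by (rule graph_given_cong) auto
  have "drgvr \<beta> \<epsilon> (Suc n) = do {\<xi> \<leftarrow> births \<epsilon> n; G \<leftarrow> graph_given \<beta> \<xi> n; y \<leftarrow> ?b;
      if y then add_vertex \<beta> (Suc n) G else remove_vertex G}"
    by (simp add: Suc bind_assoc_pmf drgvr_step_def [abs_def])
  also have "\<dots> = do {\<xi> \<leftarrow> births \<epsilon> n; y \<leftarrow> ?b; G \<leftarrow> graph_given \<beta> \<xi> n;
      if y then add_vertex \<beta> (Suc n) G else remove_vertex G}"
    by (subst bind_commute_pmf[of _ ?b]) (rule refl)
  also have "\<dots> = do {y \<leftarrow> ?b; \<xi> \<leftarrow> births \<epsilon> n; G \<leftarrow> graph_given \<beta> \<xi> n;
      if y then add_vertex \<beta> (Suc n) G else remove_vertex G}"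
    by (rule bind_commute_pmf)
  also have "\<dots> = bind_pmf (births \<epsilon> (Suc n)) (\<lambda>\<xi>. graph_given \<beta> \<xi> (Suc n))"
    unfolding births by (simp add: bind_assoc_pmf bind_return_pmf cong)
  finally show ?case .
qed

lemma vset_support:
  assumes "V \<in> set_pmf (vset \<xi> n)"
  shows "V \<subseteq> {1..n} \<and> card V = popsize \<xi> n"
  using assms
proof (induction n arbitrary: V)
  case 0
  then show ?case by simp
next
  case (Suc n)
  then obtain W where W: "W \<in> set_pmf (vset \<xi> n)"
    and V: "V \<in> set_pmf (if \<xi> (Suc n) then return_pmf (insert (Suc n) W)
      else if W = {} then return_pmf W else map_pmf (\<lambda>v. W - {v}) (pmf_of_set W))"
    by (auto simp: set_bind_pmf)
  from Suc.IH[OF W] have IH: "W \<subseteq> {1..n}" "card W = popsize \<xi> n" by auto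
  then have [simp]: "finite W" and [simp]: "Suc n \<notin> W" by (auto intro: finite_subset)
  from V consider "\<xi> (Suc n)" "V = insert (Suc n) W" | "\<not> \<xi> (Suc n)" "W = {}" "V = W"
    | v where "\<not> \<xi> (Suc n)" "v \<in> W" "V = W - {v}"
    by (auto split: if_splits)
  then show ?case
  proof cases
    case 1
    with IH show ?thesis by auto
  next
    case 2
    with IH show ?thesis by auto
  next
    case 3
    then have "V \<subseteq> {1..Suc n}"
      using IH(1) by force
    with 3 IH(2) show ?thesis by simp
  qed
qed

lemma vset_finite: "V \<in> set_pmf (vset \<xi> n) \<Longrightarrow> finite V"
  using vset_support[of V \<xi> n] finite_subset[of V "{1..n}"] by simp

lemma finite_set_pmf_vset: "finite (set_pmf (vset \<xi> n))"
  by (rule finite_subset[of _ "Pow {1..n}"]) (use vset_support in auto)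

text \<open>An edge can only appear at step \<open>Max e\<close>, when its larger end is born and
  meets the population of time \<open>Max e - 1\<close>. The resulting probability depends on the
  births alone, not on the survivors.\<close>

definition drgvr_edge_prob :: "real \<Rightarrow> (nat \<Rightarrow> bool) \<Rightarrow> nat set \<Rightarrow> real" where
  "drgvr_edge_prob \<beta> \<xi> e = min (\<beta> / real (popsize \<xi> (Max e - 1))) 1"

text \<open>Independence of the edges given the current vertex set is preserved by both kinds of
  step: a birth adds fresh independent edges, and a removal ignores the edges when it picks its
  vertex.\<close>

lemma graph_given_eq_bind_vset:
  "graph_given \<beta> \<xi> n = bind_pmf (vset \<xi> n) (\<lambda>V.
     map_pmf (Pair V) (random_subset (pairs V) (drgvr_edge_prob \<beta> \<xi>)))"
proof (induction n)
  case 0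
  then show ?case by (simp add: bind_return_pmf pairs_def)
next
  case (Suc n)
  let ?q = "drgvr_edge_prob \<beta> \<xi>"
  let ?m = "Suc n"
  show ?case
  proof (cases "\<xi> ?m")
    case True
    have "do {E \<leftarrow> random_subset (pairs V) ?q; add_vertex \<beta> ?m (V, E)} =
        map_pmf (Pair (insert ?m V)) (random_subset (pairs (insert ?m V)) ?q)"
      if V: "V \<in> set_pmf (vset \<xi> n)" for V
    proof -
      have lt: "v < ?m" if "v \<in> V" for v
        using vset_support[OF V] that by auto
      then have ins: "pairs (insert ?m V) = pairs V \<union> (\<lambda>i. {i, ?m}) ` V"
        by (rule pairs_insert)
      have "random_subset ((\<lambda>i. {i, ?m}) ` V) (\<lambda>_. min (\<beta> / real (card V)) 1) =
          random_subset ((\<lambda>i. {i, ?m}) ` V) ?q"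
      proof (rule random_subset_cong)
        fix e assume "e \<in> (\<lambda>i. {i, ?m}) ` V"
        with lt have "Max e = ?m" by (auto intro!: Max_pair)
        then show "min (\<beta> / real (card V)) 1 = ?q e"
          using vset_support[OF V] by (simp add: drgvr_edge_prob_def)
      qed simp
      moreover have "random_subset (pairs (insert ?m V)) ?q = bind_pmf (random_subset (pairs V) ?q)
          (\<lambda>E. map_pmf (\<lambda>F. E \<union> F) (random_subset ((\<lambda>i. {i, ?m}) ` V) ?q))"
        unfolding ins
        by (intro random_subset_Un pairs_disjoint_star lt finite_pairs finite_imageI vset_finite[OF V])
      ultimately show ?thesis
        by (simp add: add_vertex_def map_bind_pmf map_pmf_comp)
    qed
    then show ?thesis
      using True by (simp add: Suc bind_assoc_pmf bind_map_pmf bind_return_pmf cong: bind_pmf_cong_simp)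
  next
    case False
    have "do {E \<leftarrow> random_subset (pairs V) ?q; remove_vertex (V, E)} =
      bind_pmf (if V = {} then return_pmf V else map_pmf (\<lambda>v. V - {v}) (pmf_of_set V))
        (\<lambda>V. map_pmf (Pair V) (random_subset (pairs V) ?q))"
      if V: "V \<in> set_pmf (vset \<xi> n)" for V
    proof (cases "V = {}")
      case True
      then show ?thesis by (simp add: remove_vertex_def bind_return_pmf pairs_def)
    next
      case ne: False
      have rs: "map_pmf (\<lambda>E. {e \<in> E. v \<notin> e}) (random_subset (pairs V) ?q) =
          random_subset (pairs (V - {v})) ?q" for v
      proof -
        have "map_pmf (\<lambda>E. {e \<in> E. v \<notin> e}) (random_subset (pairs V) ?q) =
            map_pmf (\<lambda>E. E \<inter> pairs (V - {v})) (random_subset (pairs V) ?q)"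
          using set_pmf_random_subset[of "pairs V" ?q]
          by (intro map_pmf_cong refl pairs_remove) auto
        also have "\<dots> = random_subset (pairs (V - {v})) ?q"
          using vset_finite[OF V] by (intro random_subset_Int finite_pairs) (auto simp: pairs_def)
        finally show ?thesis .
      qed
      have "do {E \<leftarrow> random_subset (pairs V) ?q; remove_vertex (V, E)} =
        do {E \<leftarrow> random_subset (pairs V) ?q; v \<leftarrow> pmf_of_set V; return_pmf (V - {v}, {e \<in> E. v \<notin> e})}"
        using ne by (simp add: remove_vertex_def map_pmf_def)
      also have "\<dots> =
        do {v \<leftarrow> pmf_of_set V; E \<leftarrow> random_subset (pairs V) ?q; return_pmf (V - {v}, {e \<in> E. v \<notin> e})}"
        by (rule bind_commute_pmf)
      also have "\<dots> = do {v \<leftarrow> pmf_of_set V;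
          map_pmf (Pair (V - {v})) (map_pmf (\<lambda>E. {e \<in> E. v \<notin> e}) (random_subset (pairs V) ?q))}"
        by (simp add: map_pmf_def bind_assoc_pmf bind_return_pmf)
      also have "\<dots> = do {v \<leftarrow> pmf_of_set V; map_pmf (Pair (V - {v})) (random_subset (pairs (V - {v})) ?q)}"
        unfolding rs ..
      finally show ?thesis
        using ne by (simp add: bind_map_pmf)
    qed
    then show ?thesis
      using False by (simp add: Suc bind_assoc_pmf bind_map_pmf bind_return_pmf cong: bind_pmf_cong_simp)
  qed
qed

lemma drgvr_eq: "drgvr \<beta> \<epsilon> n = do {\<xi> \<leftarrow> births \<epsilon> n; V \<leftarrow> vset \<xi> n;
    map_pmf (Pair V) (random_subset (pairs V) (drgvr_edge_prob \<beta> \<xi>))}"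
  unfolding drgvr_eq_bind_births graph_given_eq_bind_vset ..

lemma bd_graph_eq: "bd_graph \<beta> \<epsilon> \<Delta> n = do {\<xi> \<leftarrow> births \<epsilon> n; V \<leftarrow> vset \<xi> n; bd_given \<beta> \<epsilon> \<Delta> n V}"
  unfolding bd_graph_def drgvr_eq
  by (simp add: map_bind_pmf bind_assoc_pmf map_pmf_comp map_pmf_const bind_return_pmf)

subsection \<open>Coupling of random subsets\<close>

text \<open>If the probabilities are ordered, the smaller events arise from the larger ones by
  thinning; otherwise the three events are independent. The marginals are thus right in every case,
  and only the failure probability depends on the order.\<close>

definition couple3 :: "real \<Rightarrow> real \<Rightarrow> real \<Rightarrow> (bool \<times> bool \<times> bool) pmf" where
  "couple3 a b c = (if a \<le> b \<and> b \<le> c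
     then do {z \<leftarrow> bernoulli_pmf c; y \<leftarrow> map_pmf (\<lambda>y. z \<and> y) (bernoulli_pmf (b / c));
       x \<leftarrow> map_pmf (\<lambda>x. y \<and> x) (bernoulli_pmf (a / b)); return_pmf (x, y, z)}
     else do {z \<leftarrow> bernoulli_pmf c; y \<leftarrow> bernoulli_pmf b; x \<leftarrow> bernoulli_pmf a; return_pmf (x, y, z)})"

lemma couple3_marginals:
  assumes "0 \<le> a" "0 \<le> b" "0 \<le> c" "a \<le> 1" "b \<le> 1" "c \<le> 1"
  shows "map_pmf fst (couple3 a b c) = bernoulli_pmf a"
    and "map_pmf (\<lambda>h. fst (snd h)) (couple3 a b c) = bernoulli_pmf b"
    and "map_pmf (\<lambda>h. snd (snd h)) (couple3 a b c) = bernoulli_pmf c"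
proof -
  have thin: "bind_pmf (bernoulli_pmf c) (\<lambda>z. bind_pmf (bernoulli_pmf (b / c)) (\<lambda>y. f (z \<and> y)))
    = bind_pmf (bernoulli_pmf b) f" if "0 \<le> b" "b \<le> c" "c \<le> 1" for b c and f :: "bool \<Rightarrow> bool pmf"
    using arg_cong[OF bernoulli_pmf_thinning[OF that], of "\<lambda>p. bind_pmf p f"]
    by (simp add: bind_assoc_pmf bind_map_pmf)
  show "map_pmf fst (couple3 a b c) = bernoulli_pmf a"
    using assms thin[of a b return_pmf] thin[of b c "\<lambda>y. bernoulli_pmf (a / b) \<bind> (\<lambda>x. return_pmf (y \<and> x))"]
    by (auto simp: couple3_def map_bind_pmf bind_map_pmf bind_return_pmf')
  show "map_pmf (\<lambda>h. fst (snd h)) (couple3 a b c) = bernoulli_pmf b"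
    using assms thin[of b c return_pmf]
    by (auto simp: couple3_def map_bind_pmf bind_map_pmf bind_return_pmf')
  show "map_pmf (\<lambda>h. snd (snd h)) (couple3 a b c) = bernoulli_pmf c"
    by (auto simp: couple3_def map_bind_pmf bind_map_pmf bind_return_pmf')
qed

text \<open>A violated implication has a true premise, \<open>x\<close> or \<open>y\<close>. Hence
  \<open>c\<close> does not enter the bound: at old vertices it suffices that the lower graph and
  \<open>G\<^sub>n\<close> have no edges.\<close>

lemma couple3_failure:
  assumes "0 \<le> a" "0 \<le> b" "0 \<le> c" "a \<le> 1" "b \<le> 1" "c \<le> 1"
  shows "measure_pmf.prob (couple3 a b c) {(x, y, z). \<not> ((x \<longrightarrow> y) \<and> (y \<longrightarrow> z))} \<le>
    (if a \<le> b \<and> b \<le> c then 0 else a + b)"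
proof (cases "a \<le> b \<and> b \<le> c")
  case True
  have "measure_pmf.prob (couple3 a b c) {(x, y, z). \<not> ((x \<longrightarrow> y) \<and> (y \<longrightarrow> z))} = 0"
    using True by (subst measure_pmf_zero_iff) (auto simp: couple3_def)
  then show ?thesis
    unfolding if_P[OF True] by (rule eq_refl)
next
  case False
  have "h \<in> fst -` {True} \<union> (\<lambda>h. fst (snd h)) -` {True}"
    if "h \<in> {(x, y, z). \<not> ((x \<longrightarrow> y) \<and> (y \<longrightarrow> z))}" for h :: "bool \<times> bool \<times> bool"
    using that by (cases h) (simp; blast)
  then have "measure_pmf.prob (couple3 a b c) {(x, y, z). \<not> ((x \<longrightarrow> y) \<and> (y \<longrightarrow> z))} \<le>
      measure_pmf.prob (couple3 a b c) (fst -` {True} \<union> (\<lambda>h. fst (snd h)) -` {True})"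
    by (intro measure_pmf.finite_measure_mono subsetI) simp_all
  also have "\<dots> \<le> measure_pmf.prob (couple3 a b c) (fst -` {True}) +
      measure_pmf.prob (couple3 a b c) ((\<lambda>h. fst (snd h)) -` {True})"
    by (rule measure_Un_le) simp_all
  also have "\<dots> = measure_pmf.prob (map_pmf fst (couple3 a b c)) {True} +
      measure_pmf.prob (map_pmf (\<lambda>h. fst (snd h)) (couple3 a b c)) {True}"
    by simp
  also have "\<dots> = a + b"
    unfolding couple3_marginals[OF assms] using assms by (simp add: measure_pmf_single)
  finally show ?thesis
    unfolding if_not_P[OF False] .
qed

definition couple_subsets ::
    "'a set \<Rightarrow> ('a \<Rightarrow> real) \<Rightarrow> ('a \<Rightarrow> real) \<Rightarrow> ('a \<Rightarrow> real) \<Rightarrow> ('a set \<times> 'a set \<times> 'a set) pmf" where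
  "couple_subsets C a b c =
     map_pmf (\<lambda>h. ({e \<in> C. fst (h e)}, {e \<in> C. fst (snd (h e))}, {e \<in> C. snd (snd (h e))}))
       (Pi_pmf C (False, False, False) (\<lambda>e. couple3 (a e) (b e) (c e)))"

context
  fixes C :: "'a set" and a b c :: "'a \<Rightarrow> real"
  assumes C: "finite C"
    and unit: "\<And>e. e \<in> C \<Longrightarrow> 0 \<le> a e \<and> 0 \<le> b e \<and> 0 \<le> c e \<and> a e \<le> 1 \<and> b e \<le> 1 \<and> c e \<le> 1"
begin

lemma couple_subsets_marginals:
  shows "map_pmf fst (couple_subsets C a b c) = random_subset C a"
    and "map_pmf (\<lambda>h. fst (snd h)) (couple_subsets C a b c) = random_subset C b"
    and "map_pmf (\<lambda>h. snd (snd h)) (couple_subsets C a b c) = random_subset C c"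
proof -
  have main: "map_pmf (\<lambda>h. {e \<in> C. f (h e)}) (Pi_pmf C (False, False, False) (\<lambda>e. couple3 (a e) (b e) (c e))) =
      random_subset C q"
    if "f (False, False, False) = False"
      "\<And>e. e \<in> C \<Longrightarrow> map_pmf f (couple3 (a e) (b e) (c e)) = bernoulli_pmf (q e)" for f q
  proof -
    have "Pi_pmf C False (\<lambda>e. bernoulli_pmf (q e)) =
        Pi_pmf C False (\<lambda>e. map_pmf f (couple3 (a e) (b e) (c e)))"
      using that(2) by (intro Pi_pmf_cong) auto
    also have "\<dots> = map_pmf (\<lambda>h. f \<circ> h) (Pi_pmf C (False, False, False) (\<lambda>e. couple3 (a e) (b e) (c e)))"
      using C that(1) by (rule Pi_pmf_map)
    finally show ?thesis
      unfolding random_subset_def by (simp add: map_pmf_comp)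
  qed
  show "map_pmf fst (couple_subsets C a b c) = random_subset C a"
    unfolding couple_subsets_def map_pmf_comp fst_conv snd_conv
    using unit by (intro main couple3_marginals) auto
  show "map_pmf (\<lambda>h. fst (snd h)) (couple_subsets C a b c) = random_subset C b"
    unfolding couple_subsets_def map_pmf_comp fst_conv snd_conv
    using unit by (intro main[of "\<lambda>h. fst (snd h)"] couple3_marginals) auto
  show "map_pmf (\<lambda>h. snd (snd h)) (couple_subsets C a b c) = random_subset C c"
    unfolding couple_subsets_def map_pmf_comp fst_conv snd_conv
    using unit by (intro main[of "\<lambda>h. snd (snd h)"] couple3_marginals) auto
qed

lemma couple_subsets_failure:
  "measure_pmf.prob (couple_subsets C a b c) {(A, G, B). \<not> (A \<subseteq> G \<and> G \<subseteq> B)} \<le>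
    (\<Sum>e\<in>C. if a e \<le> b e \<and> b e \<le> c e then 0 else a e + b e)"
proof -
  let ?F = "{(x, y, z). \<not> ((x \<longrightarrow> y) \<and> (y \<longrightarrow> z))}"
  let ?P = "Pi_pmf C (False, False, False) (\<lambda>e. couple3 (a e) (b e) (c e))"
  have "measure_pmf.prob (couple_subsets C a b c) {(A, G, B). \<not> (A \<subseteq> G \<and> G \<subseteq> B)} \<le>
      measure_pmf.prob ?P (\<Union>e\<in>C. (\<lambda>h. h e) -` ?F)"
    unfolding couple_subsets_def measure_map_pmf
  proof (intro measure_pmf.finite_measure_mono subsetI)
    fix h assume "h \<in> (\<lambda>h. ({e \<in> C. fst (h e)}, {e \<in> C. fst (snd (h e))}, {e \<in> C. snd (snd (h e))})) -`
      {(A, G, B). \<not> (A \<subseteq> G \<and> G \<subseteq> B)}"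
    then obtain e where "e \<in> C"
      "\<not> ((fst (h e) \<longrightarrow> fst (snd (h e))) \<and> (fst (snd (h e)) \<longrightarrow> snd (snd (h e))))"
      by blast
    then show "h \<in> (\<Union>e\<in>C. (\<lambda>h. h e) -` ?F)"
      by (intro UN_I[of e]) (simp_all add: case_prod_unfold)
  qed simp
  also have "\<dots> \<le> (\<Sum>e\<in>C. measure_pmf.prob ?P ((\<lambda>h. h e) -` ?F))"
    using C by (rule measure_UNION_le) simp
  also have "\<dots> \<le> (\<Sum>e\<in>C. if a e \<le> b e \<and> b e \<le> c e then 0 else a e + b e)"
  proof (rule sum_mono)
    fix e assume e: "e \<in> C"
    have "measure_pmf.prob ?P ((\<lambda>h. h e) -` ?F) = measure_pmf.prob (map_pmf (\<lambda>h. h e) ?P) ?F"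
      by simp
    also have "map_pmf (\<lambda>h. h e) ?P = couple3 (a e) (b e) (c e)"
      using C e by (simp add: Pi_pmf_component)
    finally show "measure_pmf.prob ?P ((\<lambda>h. h e) -` ?F) \<le>
        (if a e \<le> b e \<and> b e \<le> c e then 0 else a e + b e)"
      using couple3_failure[of "a e" "b e" "c e"] unit[OF e] by simp
  qed
  finally show ?thesis .
qed

end

definition bd_edge_prob :: "real \<Rightarrow> real \<Rightarrow> real \<Rightarrow> nat \<Rightarrow> nat set \<Rightarrow> nat set \<Rightarrow> real" where
  "bd_edge_prob \<beta> \<epsilon> \<Delta> n V e = min (bd_prob \<beta> \<epsilon> \<Delta> n (vertex_index V (Max e))) 1"

definition coupling :: "real \<Rightarrow> real \<Rightarrow> nat \<Rightarrow> real \<Rightarrow> (graph \<times> graph \<times> graph) pmf" where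
  "coupling \<beta> \<epsilon> n \<delta> = do {\<xi> \<leftarrow> births \<epsilon> n; V \<leftarrow> vset \<xi> n;
     map_pmf (\<lambda>(A, G, B). ((V, A), (V, G), (V, B)))
       (couple_subsets (pairs V) (bd_edge_prob \<beta> \<epsilon> (1 - \<delta>) n V) (drgvr_edge_prob \<beta> \<xi>)
         (bd_edge_prob \<beta> \<epsilon> (1 + \<delta>) n V))}"

lemma drgvr_edge_prob_unit: "\<beta> \<ge> 0 \<Longrightarrow> 0 \<le> drgvr_edge_prob \<beta> \<xi> e \<and> drgvr_edge_prob \<beta> \<xi> e \<le> 1"
  by (simp add: drgvr_edge_prob_def)

lemma bd_edge_prob_unit:
  "\<beta> \<ge> 0 \<Longrightarrow> \<Delta> \<ge> 0 \<Longrightarrow> 0 \<le> bd_edge_prob \<beta> \<epsilon> \<Delta> n V e \<and> bd_edge_prob \<beta> \<epsilon> \<Delta> n V e \<le> 1"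
  by (simp add: bd_edge_prob_def bd_prob_def Let_def)

lemma bd_given_eq:
  "bd_given \<beta> \<epsilon> \<Delta> n V = map_pmf (Pair V) (random_subset (pairs V) (bd_edge_prob \<beta> \<epsilon> \<Delta> n V))"
  by (simp add: bd_given_def pairs_def bd_edge_prob_def [abs_def])

lemma bd_drgvr_coupling_coupling:
  assumes "\<beta> > 0" "\<bar>\<delta>\<bar> < 1"
  shows "bd_drgvr_coupling \<beta> \<epsilon> n (1 - \<delta>) (1 + \<delta>) (coupling \<beta> \<epsilon> n \<delta>)"
proof -
  let ?C = "\<lambda>\<xi> V. couple_subsets (pairs V) (bd_edge_prob \<beta> \<epsilon> (1 - \<delta>) n V) (drgvr_edge_prob \<beta> \<xi>)
         (bd_edge_prob \<beta> \<epsilon> (1 + \<delta>) n V)"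
  have marg: "map_pmf fst (?C \<xi> V) = random_subset (pairs V) (bd_edge_prob \<beta> \<epsilon> (1 - \<delta>) n V) \<and>
     map_pmf (\<lambda>h. fst (snd h)) (?C \<xi> V) = random_subset (pairs V) (drgvr_edge_prob \<beta> \<xi>) \<and>
     map_pmf (\<lambda>h. snd (snd h)) (?C \<xi> V) = random_subset (pairs V) (bd_edge_prob \<beta> \<epsilon> (1 + \<delta>) n V)"
    if "V \<in> set_pmf (vset \<xi> n)" for \<xi> V
    using assms drgvr_edge_prob_unit[of \<beta> \<xi>] bd_edge_prob_unit[of \<beta> _ \<epsilon> n V]
    by (intro conjI couple_subsets_marginals finite_pairs vset_finite[OF that]) auto
  let ?T = "\<lambda>V. map_pmf (\<lambda>(A, G, B). ((V, A), (V, G), (V, B)))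
    :: (nat set set \<times> nat set set \<times> nat set set) pmf \<Rightarrow> (graph \<times> graph \<times> graph) pmf"
  have T: "map_pmf (\<lambda>(A, G, B). A) (?T V C) = map_pmf (Pair V) (map_pmf fst C)"
    "map_pmf (\<lambda>(A, G, B). G) (?T V C) = map_pmf (Pair V) (map_pmf (\<lambda>h. fst (snd h)) C)"
    "map_pmf (\<lambda>(A, G, B). B) (?T V C) = map_pmf (Pair V) (map_pmf (\<lambda>h. snd (snd h)) C)" for V C
    by (simp_all add: map_pmf_comp case_prod_unfold)
  have "map_pmf (\<lambda>(A, G, B). A) (coupling \<beta> \<epsilon> n \<delta>) = bd_graph \<beta> \<epsilon> (1 - \<delta>) n"
    unfolding coupling_def bd_graph_eq bd_given_eq map_bind_pmf T
    using marg by (intro bind_pmf_cong refl arg_cong[of _ _ "map_pmf (Pair _)"]) simp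
  moreover have "map_pmf (\<lambda>(A, G, B). G) (coupling \<beta> \<epsilon> n \<delta>) = drgvr \<beta> \<epsilon> n"
    unfolding coupling_def drgvr_eq map_bind_pmf T
    using marg by (intro bind_pmf_cong refl arg_cong[of _ _ "map_pmf (Pair _)"]) simp
  moreover have "map_pmf (\<lambda>(A, G, B). B) (coupling \<beta> \<epsilon> n \<delta>) = bd_graph \<beta> \<epsilon> (1 + \<delta>) n"
    unfolding coupling_def bd_graph_eq bd_given_eq map_bind_pmf T
    using marg by (intro bind_pmf_cong refl arg_cong[of _ _ "map_pmf (Pair _)"]) simp
  moreover have "AE (A, G, B) in measure_pmf (coupling \<beta> \<epsilon> n \<delta>).
      vertices A = vertices G \<and> vertices B = vertices G"
    by (auto simp: AE_measure_pmf_iff coupling_def)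
  ultimately show ?thesis
    by (simp add: bd_drgvr_coupling_def)
qed

section \<open>Survivors\<close>

subsection \<open>The age distribution of the survivors\<close>

text \<open>From here on \<open>vertex_index V s\<close> is also used for labels \<open>s\<close>
  outside \<open>V\<close>: it counts the survivors with label at most \<open>s\<close>.\<close>

lemma vertex_index_remove:
  assumes "finite V" "v \<in> V"
  shows "vertex_index (V - {v}) s = (if v \<le> s then vertex_index V s - 1 else vertex_index V s)"
proof -
  have "{u \<in> V - {v}. u \<le> s} = {u \<in> V. u \<le> s} - {v}" by auto
  with assms show ?thesis
    unfolding vertex_index_def by (simp add: card_Diff_singleton_if)
qed

text \<open>A uniform removal hits one of the N counted vertices with probability N /
  \<open>card V\<close>. For N = 0 this weight vanishes, so the truncated difference N - 1 does no
  harm.\<close>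

lemma expectation_remove_vertex:
  fixes f :: "nat \<Rightarrow> real"
  assumes "finite V" "V \<noteq> {}"
  shows "measure_pmf.expectation (map_pmf (\<lambda>v. V - {v}) (pmf_of_set V)) (\<lambda>W. f (vertex_index W s)) =
    f (vertex_index V s) +
      real (vertex_index V s) / real (card V) * (f (vertex_index V s - 1) - f (vertex_index V s))"
proof -
  let ?N = "vertex_index V s"
  have "(\<Sum>v\<in>V. f (vertex_index (V - {v}) s)) =
      (\<Sum>v\<in>V. f ?N + (if v \<le> s then f (?N - 1) - f ?N else 0))"
    using assms(1) by (intro sum.cong) (simp_all add: vertex_index_remove)
  also have "\<dots> = real (card V) * f ?N + real ?N * (f (?N - 1) - f ?N)"
    using assms(1) by (simp add: sum.distrib sum.If_cases vertex_index_def Int_def)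
  finally show ?thesis
    using assms by (simp add: integral_pmf_of_set field_simps)
qed

text \<open>
  Removal steps that find no vertex contribute the factor \<open>1\<close>, because \<open>1 / 0 = 0\<close>.
\<close>

definition surv_mean :: "(nat \<Rightarrow> bool) \<Rightarrow> nat \<Rightarrow> nat \<Rightarrow> real" where
  "surv_mean \<xi> s n = real (popsize \<xi> s) *
     (\<Prod>i\<in>{s<..n}. if \<xi> i then 1 else 1 - 1 / real (popsize \<xi> (i - 1)))"

lemma surv_mean_refl: "surv_mean \<xi> s s = real (popsize \<xi> s)"
  by (simp add: surv_mean_def)

lemma surv_mean_Suc:
  assumes "s \<le> n"
  shows "surv_mean \<xi> s (Suc n) =
    (if \<xi> (Suc n) then surv_mean \<xi> s n else surv_mean \<xi> s n * (1 - 1 / real (popsize \<xi> n)))"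
proof -
  have "{s<..Suc n} = insert (Suc n) {s<..n}" using assms by auto
  then show ?thesis by (simp add: surv_mean_def)
qed

text \<open>One step of the chain that counts the survivors with label at most \<open>s\<close>:
  later births do not affect it, and a removal sees the deterministic size
  \<open>popsize \<xi> n\<close>.\<close>

lemma expectation_vset_Suc:
  fixes f :: "nat \<Rightarrow> real"
  assumes "s \<le> n"
  shows "measure_pmf.expectation (vset \<xi> (Suc n)) (\<lambda>V. f (vertex_index V s)) =
    measure_pmf.expectation (vset \<xi> n) (\<lambda>V. if \<xi> (Suc n) then f (vertex_index V s)
      else f (vertex_index V s) + real (vertex_index V s) / real (popsize \<xi> n) *
        (f (vertex_index V s - 1) - f (vertex_index V s)))"
proof -
  let ?K = "\<lambda>V. if \<xi> (Suc n) then return_pmf (insert (Suc n) V)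
     else if V = {} then return_pmf V else map_pmf (\<lambda>v. V - {v}) (pmf_of_set V)"
  have "measure_pmf.expectation (?K V) (\<lambda>V. f (vertex_index V s)) =
      (if \<xi> (Suc n) then f (vertex_index V s)
      else f (vertex_index V s) + real (vertex_index V s) / real (popsize \<xi> n) *
        (f (vertex_index V s - 1) - f (vertex_index V s)))"
    if V: "V \<in> set_pmf (vset \<xi> n)" for V
  proof -
    have "{u. (u = Suc n \<or> u \<in> V) \<and> u \<le> s} = {u \<in> V. u \<le> s}"
      using assms by auto
    then have "vertex_index (insert (Suc n) V) s = vertex_index V s"
      by (simp add: vertex_index_def)
    \<comment> \<open>This covers a removal that finds no vertex: the count is 0, so the correction
      term vanishes.\<close>
    moreover have "vertex_index {} s = 0" by (simp add: vertex_index_def)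
    ultimately show ?thesis
      using vset_support[OF V] expectation_remove_vertex[OF vset_finite[OF V], of f s]
      by (auto simp del: integral_map_pmf)
  qed
  moreover have "finite (set_pmf (?K V))" if "V \<in> set_pmf (vset \<xi> n)" for V
    using vset_finite[OF that] by simp
  ultimately show ?thesis
    unfolding vset.simps
    by (subst expectation_bind_pmf_finite[OF finite_set_pmf_vset])
       (auto intro!: integral_cong_AE simp: AE_measure_pmf_iff)
qed

lemma expectation_vertex_index:
  assumes "s \<le> n"
  shows "measure_pmf.expectation (vset \<xi> n) (\<lambda>V. real (vertex_index V s)) = surv_mean \<xi> s n"
  using assms
proof (induction n rule: dec_induct)
  case base
  have "vertex_index V s = popsize \<xi> s" if V: "V \<in> set_pmf (vset \<xi> s)" for V
  proof -
    have "{u \<in> V. u \<le> s} = V" using vset_support[OF V] by auto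
    then show ?thesis using vset_support[OF V] by (simp add: vertex_index_def)
  qed
  then have "measure_pmf.expectation (vset \<xi> s) (\<lambda>V. real (vertex_index V s)) =
      measure_pmf.expectation (vset \<xi> s) (\<lambda>V. real (popsize \<xi> s))"
    by (intro integral_cong_AE) (auto simp: AE_measure_pmf_iff)
  then show ?case by (simp add: surv_mean_refl)
next
  case (step n)
  \<comment> \<open>The count is an eigenfunction of a removal, with eigenvalue
    \<open>1 - 1 / x\<close>, so the mean obeys a product formula exactly.\<close>
  have eq: "real N + real N / x * (real (N - 1) - real N) = real N * (1 - 1 / x)" for N x
    by (cases "x = 0"; cases N) (simp_all add: field_simps)
  show ?case
    unfolding expectation_vset_Suc[OF step.hyps(1), where f = real]
    unfolding eq using step by (simp add: surv_mean_Suc)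
qed

text \<open>The function N (N - 1) is an eigenfunction of a removal too, with eigenvalue
  \<open>1 - 2 / x\<close>, at most \<open>(1 - 1 / x)\<^sup>2\<close>. Survivals are thus
  negatively correlated in pairs on average.\<close>

lemma expectation_vertex_index_factorial_moment:
  assumes "s \<le> n"
  shows "measure_pmf.expectation (vset \<xi> n) (\<lambda>V. real (vertex_index V s) * (real (vertex_index V s) - 1))
    \<le> (surv_mean \<xi> s n)\<^sup>2"
  using assms
proof (induction n rule: dec_induct)
  case base
  have "vertex_index V s = popsize \<xi> s" if V: "V \<in> set_pmf (vset \<xi> s)" for V
  proof -
    have "{u \<in> V. u \<le> s} = V" using vset_support[OF V] by auto
    then show ?thesis using vset_support[OF V] by (simp add: vertex_index_def)
  qed
  then have "measure_pmf.expectation (vset \<xi> s) (\<lambda>V. real (vertex_index V s) * (real (vertex_index V s) - 1)) =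
      measure_pmf.expectation (vset \<xi> s) (\<lambda>V. real (popsize \<xi> s) * (real (popsize \<xi> s) - 1))"
    by (intro integral_cong_AE) (auto simp: AE_measure_pmf_iff)
  then show ?case by (simp add: surv_mean_refl power2_eq_square algebra_simps)
next
  case (step n)
  let ?f = "\<lambda>N. real N * (real N - 1)"
  let ?E = "measure_pmf.expectation (vset \<xi> n) (\<lambda>V. ?f (vertex_index V s))"
  let ?x = "real (popsize \<xi> n)"
  have nonneg: "?f N \<ge> 0" for N by (cases N) auto
  have eq: "?f N + real N / x * (?f (N - 1) - ?f N) = ?f N * (1 - 2 / x)" for N x
    by (cases "x = 0"; cases N) (simp_all add: field_simps)
  show ?case
  proof (cases "\<xi> (Suc n)")
    case True
    with step show ?thesis
      unfolding expectation_vset_Suc[OF step.hyps(1), where f = ?f] by (simp add: surv_mean_Suc)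
  next
    case False
    have "measure_pmf.expectation (vset \<xi> (Suc n)) (\<lambda>V. ?f (vertex_index V s)) = ?E * (1 - 2 / ?x)"
      unfolding expectation_vset_Suc[OF step.hyps(1), where f = ?f] using False
      by (simp only: eq if_False integral_mult_left_zero)
    also have "\<dots> \<le> ?E * (1 - 1 / ?x)\<^sup>2"
      using nonneg by (intro mult_left_mono integral_nonneg_AE)
        (auto simp: AE_measure_pmf_iff power2_eq_square algebra_simps)
    also have "\<dots> \<le> (surv_mean \<xi> s n)\<^sup>2 * (1 - 1 / ?x)\<^sup>2"
      using step.IH by (intro mult_right_mono) auto
    finally show ?thesis
      using False step.hyps by (simp add: surv_mean_Suc power_mult_distrib)
  qed
qed

text \<open>The factorial moment bound makes the variance at most the mean, and Chebyshev's
  inequality for a relative deviation \<open>t\<close> then loses only one factor of the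
  mean.\<close>

lemma vertex_index_concentration:
  assumes "s \<le> n" "t > 0" "surv_mean \<xi> s n > 0"
  shows "measure_pmf.prob (vset \<xi> n) {V. t * surv_mean \<xi> s n \<le> \<bar>real (vertex_index V s) - surv_mean \<xi> s n\<bar>}
    \<le> 1 / (t\<^sup>2 * surv_mean \<xi> s n)"
proof -
  let ?M = "vset \<xi> n" and ?\<mu> = "surv_mean \<xi> s n"
  let ?N = "\<lambda>V. real (vertex_index V s)"
  have int: "integrable ?M f" for f :: "nat set \<Rightarrow> real"
    by (rule integrable_measure_pmf_finite[OF finite_set_pmf_vset])
  have "measure_pmf.expectation ?M (\<lambda>V. (?N V - ?\<mu>)\<^sup>2) =
      measure_pmf.expectation ?M (\<lambda>V. ?N V * (?N V - 1) + (1 - 2 * ?\<mu>) * ?N V + ?\<mu>\<^sup>2)"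
    by (intro Bochner_Integration.integral_cong) (auto simp: power2_eq_square algebra_simps)
  also have "\<dots> = measure_pmf.expectation ?M (\<lambda>V. ?N V * (?N V - 1)) + (1 - 2 * ?\<mu>) * ?\<mu> + ?\<mu>\<^sup>2"
    by (simp add: int expectation_vertex_index[OF assms(1)])
  also have "\<dots> \<le> ?\<mu>\<^sup>2 + (1 - 2 * ?\<mu>) * ?\<mu> + ?\<mu>\<^sup>2"
    using expectation_vertex_index_factorial_moment[OF assms(1), of \<xi>] by simp
  also have "\<dots> = ?\<mu>"
    by (simp add: power2_eq_square algebra_simps)
  finally have var: "measure_pmf.expectation ?M (\<lambda>V. (?N V - ?\<mu>)\<^sup>2) \<le> ?\<mu>" .
  have "measure_pmf.prob ?M {V \<in> space ?M. t * ?\<mu> \<le> \<bar>?N V - measure_pmf.expectation ?M ?N\<bar>}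
      \<le> measure_pmf.expectation ?M (\<lambda>V. (?N V - measure_pmf.expectation ?M ?N)\<^sup>2) / (t * ?\<mu>)\<^sup>2"
    using assms by (intro measure_pmf.Chebyshev_inequality int) auto
  also have "\<dots> \<le> ?\<mu> / (t * ?\<mu>)\<^sup>2"
    unfolding expectation_vertex_index[OF assms(1)] using var by (intro divide_right_mono) auto
  also have "\<dots> = 1 / (t\<^sup>2 * ?\<mu>)"
    using assms by (simp add: power2_eq_square field_simps)
  finally show ?thesis
    by (simp add: expectation_vertex_index[OF assms(1)])
qed

text \<open>Markov's inequality, for labels so old that the mean number of survivors tends to
  0.\<close>

lemma prob_vertex_index_pos:
  assumes "s \<le> n"
  shows "measure_pmf.prob (vset \<xi> n) {V. vertex_index V s \<noteq> 0} \<le> surv_mean \<xi> s n"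
proof -
  have int: "integrable (vset \<xi> n) f" for f :: "nat set \<Rightarrow> real"
    by (rule integrable_measure_pmf_finite[OF finite_set_pmf_vset])
  have "measure_pmf.prob (vset \<xi> n) {V. vertex_index V s \<noteq> 0} =
      measure_pmf.expectation (vset \<xi> n) (indicator {V. vertex_index V s \<noteq> 0})"
    by simp
  also have "\<dots> \<le> measure_pmf.expectation (vset \<xi> n) (\<lambda>V. real (vertex_index V s))"
    by (intro integral_mono int) (auto simp: indicator_def)
  finally show ?thesis
    unfolding expectation_vertex_index[OF assms] .
qed

subsection \<open>The size of the population\<close>

definition num_births :: "(nat \<Rightarrow> bool) \<Rightarrow> nat \<Rightarrow> nat" where
  "num_births \<xi> i = card {j \<in> {1..i}. \<xi> j}"

lemma num_births_0 [simp]: "num_births \<xi> 0 = 0"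
  by (simp add: num_births_def)

lemma num_births_Suc: "num_births \<xi> (Suc i) = num_births \<xi> i + (if \<xi> (Suc i) then 1 else 0)"
proof -
  have "{j \<in> {1..Suc i}. \<xi> j} = {j \<in> {1..i}. \<xi> j} \<union> (if \<xi> (Suc i) then {Suc i} else {})"
    by (auto simp: le_Suc_eq)
  then show ?thesis
    by (simp add: num_births_def)
qed

text \<open>The left-hand side is the walk with steps 1 and -1. The population is this walk
  reflected at 0, and the idle removals can only lift it.\<close>

lemma popsize_ge: "2 * int (num_births \<xi> i) - int i \<le> int (popsize \<xi> i)"
  by (induction i) (auto simp: num_births_Suc)

text \<open>The excess over the free walk is caused by idle removals, so it cannot exceed the depth
  \<open>m\<close> to which the walk has fallen below 0.\<close>

lemma popsize_le:
  assumes "\<And>j. j \<le> i \<Longrightarrow> - int m \<le> 2 * int (num_births \<xi> j) - int j"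
  shows "int (popsize \<xi> i) \<le> 2 * int (num_births \<xi> i) - int i + int m"
  using assms
proof (induction i)
  case (Suc i)
  have "int (popsize \<xi> i) \<le> 2 * int (num_births \<xi> i) - int i + int m"
    using Suc by auto
  then show ?case
    \<comment> \<open>At an idle removal the new size is 0, and the depth bound at time
      \<open>Suc i\<close> is the claim itself.\<close>
    using Suc.prems[of "Suc i"] by (cases "popsize \<xi> i = 0") (auto simp: num_births_Suc)
qed auto

text \<open>The exponent 3/4 exceeds 1/2, so that Hoeffding's bounds are summable, and is below 1,
  so that the relative error i^(-1/4) vanishes and the errors i^(-5/4) of the logarithmic increments
  are summable. Half of the constant 2 is for the fluctuation of the births, half for the idle
  removals.\<close>

definition band :: "real \<Rightarrow> nat \<Rightarrow> nat \<Rightarrow> (nat \<Rightarrow> bool) set" where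
  "band \<epsilon> s n = {\<xi>. \<forall>i\<in>{s..n}. \<bar>real (popsize \<xi> i) - 2 * \<epsilon> * real i\<bar> \<le> 2 * real i powr (3 / 4)}"

text \<open>Up to time \<open>m\<close> the walk cannot fall below -\<open>m\<close>, and from then
  on the drift keeps it positive. So idle removals lift the population by at most \<open>m\<close>,
  which is absorbed once \<open>real s powr (3 / 4)\<close> exceeds \<open>m\<close>.\<close>

lemma popsize_band:
  assumes drift: "\<And>i. i \<ge> m \<Longrightarrow> real i powr (3 / 4) \<le> 2 * \<epsilon> * real i"
    and births: "\<And>i. i \<in> {m..n} \<Longrightarrow>
      \<bar>real (num_births \<xi> i) - real i * birth_prob \<epsilon>\<bar> < real i powr (3 / 4) / 2"
    and s: "s \<ge> m" "real m \<le> real s powr (3 / 4)"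
  shows "\<xi> \<in> band \<epsilon> s n"
  unfolding band_def
proof (intro CollectI ballI)
  fix i assume i: "i \<in> {s..n}"
  let ?y = "\<lambda>j. 2 * int (num_births \<xi> j) - int j"
  have y: "\<bar>real_of_int (?y j) - 2 * \<epsilon> * real j\<bar> < real j powr (3 / 4)" if "j \<in> {m..n}" for j
  proof -
    have "real_of_int (?y j) - 2 * \<epsilon> * real j = 2 * (real (num_births \<xi> j) - real j * birth_prob \<epsilon>)"
      by (simp add: birth_prob_def algebra_simps)
    with births[OF that] show ?thesis by (simp only: abs_mult) simp
  qed
  have "- int m \<le> ?y j" if "j \<le> i" for j
  proof (cases "j < m")
    case True
    then show ?thesis by simp
  next
    case False
    with that i have "j \<in> {m..n}" by auto
    from y[OF this] drift[of j] False have "real_of_int (?y j) > 0" by simp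
    then show ?thesis by linarith
  qed
  then have "int (popsize \<xi> i) \<le> ?y i + int m" by (rule popsize_le)
  moreover have "?y i \<le> int (popsize \<xi> i)" by (rule popsize_ge)
  ultimately have "real_of_int (?y i) \<le> real (popsize \<xi> i)" "real (popsize \<xi> i) \<le> real_of_int (?y i) + real m"
    by linarith+
  moreover have "real m \<le> real i powr (3 / 4)"
    using s(2) i by (intro order.trans[OF s(2)] powr_mono2) auto
  ultimately show "\<bar>real (popsize \<xi> i) - 2 * \<epsilon> * real i\<bar> \<le> 2 * real i powr (3 / 4)"
    using y[of i] i s(1) by auto
qed

lemma num_births_binomial:
  assumes "i \<le> n" "birth_prob \<epsilon> \<in> {0..1}"
  shows "map_pmf (\<lambda>\<xi>. num_births \<xi> i) (births \<epsilon> n) = binomial_pmf i (birth_prob \<epsilon>)"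
proof -
  have "Pi_pmf {1..i} False (\<lambda>_. bernoulli_pmf (birth_prob \<epsilon>)) =
      map_pmf (\<lambda>f x. if x \<in> {1..i} then f x else False) (births \<epsilon> n)"
    unfolding births_def using assms by (intro Pi_pmf_subset) auto
  moreover have "binomial_pmf i (birth_prob \<epsilon>) =
      map_pmf (\<lambda>f. card {x \<in> {1..i}. f x}) (Pi_pmf {1..i} False (\<lambda>_. bernoulli_pmf (birth_prob \<epsilon>)))"
    using assms by (intro binomial_pmf_altdef') auto
  moreover have "{x \<in> {1..i}. if x \<in> {1..i} then f x else False} = {x \<in> {1..i}. f x}" for f
    by auto
  ultimately show ?thesis
    by (simp add: map_pmf_comp num_births_def)
qed

lemma prob_num_births_deviation:
  assumes "1 \<le> i" "i \<le> n" "birth_prob \<epsilon> \<in> {0..1}"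
  shows "measure_pmf.prob (births \<epsilon> n)
      {\<xi>. real i powr (3 / 4) / 2 \<le> \<bar>real (num_births \<xi> i) - real i * birth_prob \<epsilon>\<bar>}
    \<le> 2 * exp (- (real i powr (1 / 2) / 2))"
proof -
  let ?p = "birth_prob \<epsilon>"
  interpret binomial_distribution i ?p
    by unfold_locales (use assms in auto)
  have "measure_pmf.prob (births \<epsilon> n)
      {\<xi>. real i powr (3 / 4) / 2 \<le> \<bar>real (num_births \<xi> i) - real i * ?p\<bar>} =
      measure_pmf.prob (map_pmf (\<lambda>\<xi>. num_births \<xi> i) (births \<epsilon> n))
        {x. real i powr (3 / 4) / 2 \<le> \<bar>real x - real i * ?p\<bar>}"
    by simp
  also have "\<dots> \<le> 2 * exp (- 2 * (real i powr (3 / 4) / 2)\<^sup>2 / real i)"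
    unfolding num_births_binomial[OF assms(2,3)] using assms(1) by (intro prob_abs_ge) auto
  also have "- 2 * (real i powr (3 / 4) / 2)\<^sup>2 / real i = - (real i powr (1 / 2) / 2)"
  proof -
    have "(real i powr (3 / 4))\<^sup>2 = real i powr (1 / 2) * real i"
      using assms(1) powr_mult_base[of "real i" "1 / 2"]
      by (simp add: power2_eq_square powr_add [symmetric] mult.commute)
    then show ?thesis
      using assms(1) by (simp add: power_divide)
  qed
  finally show ?thesis .
qed

lemma summable_exp_sqrt: "summable (\<lambda>i. 2 * exp (- (real i powr (1 / 2) / 2)))"
proof (rule summable_comparison_test_ev)
  show "\<forall>\<^sub>F i in sequentially. norm (2 * exp (- (real i powr (1 / 2) / 2))) \<le> real i powr (- 2)"
    by simp real_asymp
  show "summable (\<lambda>i. real i powr (- 2))"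
    by (simp add: summable_real_powr_iff)
qed

lemma summable_tail_small:
  fixes f :: "nat \<Rightarrow> real"
  assumes "summable f" "\<And>i. f i \<ge> 0" "e > 0"
  shows "\<forall>\<^sub>F m in sequentially. \<forall>n. sum f {m..<n} \<le> e"
proof -
  from assms(1,3) obtain N where "\<And>m n. m \<ge> N \<Longrightarrow> norm (sum f {m..<n}) < e"
    unfolding summable_Cauchy by blast
  then have "\<forall>n. sum f {m..<n} \<le> e" if "m \<ge> N" for m
    using that assms(2) by (simp add: sum_nonneg less_imp_le)
  then show ?thesis
    by (auto simp: eventually_sequentially)
qed

text \<open>The bound is uniform in \<open>n\<close>, because the tail of the summable Hoeffding
  bounds controls all later times at once. The time \<open>m\<close> of this tail is fixed before
  \<open>s\<close>, which must be large enough to absorb it.\<close>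

lemma band_likely:
  assumes "0 < \<epsilon>" "\<epsilon> < 1 / 2" "\<eta> > 0"
  shows "\<forall>\<^sub>F s in sequentially. \<forall>n. measure_pmf.prob (births \<epsilon> n) (- band \<epsilon> s n) \<le> \<eta>"
proof -
  let ?g = "\<lambda>i. 2 * exp (- (real i powr (1 / 2) / 2))"
  let ?F = "\<lambda>i. {\<xi>. real i powr (3 / 4) / 2 \<le> \<bar>real (num_births \<xi> i) - real i * birth_prob \<epsilon>\<bar>}"
  have p: "birth_prob \<epsilon> \<in> {0..1}"
    using assms by (simp add: birth_prob_def)
  have "\<forall>\<^sub>F m in sequentially. \<forall>n. sum ?g {m..<n} \<le> \<eta>"
    using assms by (intro summable_tail_small summable_exp_sqrt) auto
  moreover have "\<forall>\<^sub>F m in sequentially. real m powr (3 / 4) \<le> 2 * \<epsilon> * real m"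
    using assms(1) by real_asymp
  then have "\<forall>\<^sub>F m in sequentially. \<forall>i\<ge>m. real i powr (3 / 4) \<le> 2 * \<epsilon> * real i"
    by (rule eventually_all_ge_at_top)
  moreover have "\<forall>\<^sub>F m in sequentially. m \<ge> (1::nat)"
    by (rule eventually_ge_at_top)
  ultimately obtain m where m: "\<And>n. sum ?g {m..<n} \<le> \<eta>"
    "\<And>i. i \<ge> m \<Longrightarrow> real i powr (3 / 4) \<le> 2 * \<epsilon> * real i" "m \<ge> 1"
    using eventually_happens'[OF sequentially_bot eventually_conj[OF _ eventually_conj]] by blast
  have "\<forall>\<^sub>F s in sequentially. real m \<le> real s powr (3 / 4)"
    by real_asymp
  moreover have "\<forall>\<^sub>F s in sequentially. s \<ge> m"
    by (rule eventually_ge_at_top)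
  ultimately show ?thesis
  proof eventually_elim
    case (elim s)
    show ?case
    proof
      fix n
      have "- band \<epsilon> s n \<subseteq> (\<Union>i\<in>{m..<Suc n}. ?F i)"
      proof
        fix \<xi> assume "\<xi> \<in> - band \<epsilon> s n"
        moreover have "\<xi> \<in> band \<epsilon> s n"
          if "\<forall>i\<in>{m..n}. \<bar>real (num_births \<xi> i) - real i * birth_prob \<epsilon>\<bar> < real i powr (3 / 4) / 2"
          using that elim by (intro popsize_band[of m] m(2)) auto
        ultimately have "\<not> (\<forall>i\<in>{m..n}. \<bar>real (num_births \<xi> i) - real i * birth_prob \<epsilon>\<bar> < real i powr (3 / 4) / 2)"
          by auto
        then show "\<xi> \<in> (\<Union>i\<in>{m..<Suc n}. ?F i)"
          by (auto simp: not_less)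
      qed
      then have "measure_pmf.prob (births \<epsilon> n) (- band \<epsilon> s n) \<le>
          measure_pmf.prob (births \<epsilon> n) (\<Union>i\<in>{m..<Suc n}. ?F i)"
        by (intro measure_pmf.finite_measure_mono) auto
      also have "\<dots> \<le> (\<Sum>i\<in>{m..<Suc n}. measure_pmf.prob (births \<epsilon> n) (?F i))"
        by (intro measure_UNION_le) auto
      also have "\<dots> \<le> sum ?g {m..<Suc n}"
        using m(3) p by (intro sum_mono prob_num_births_deviation) auto
      also have "\<dots> \<le> \<eta>" by (rule m(1))
      finally show "measure_pmf.prob (births \<epsilon> n) (- band \<epsilon> s n) \<le> \<eta>" .
    qed
  qed
qed

subsection \<open>The expected number of survivors\<close>

lemma ln_increment_bounds:
  assumes "x > (1::real)"
  shows "1 / (x + 1) \<le> ln (x + 1) - ln x" "ln (x + 1) - ln x \<le> 1 / x"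
    "1 / x \<le> ln x - ln (x - 1)" "ln x - ln (x - 1) \<le> 1 / (x - 1)"
proof -
  have *: "1 / (y + 1) \<le> ln (y + 1) - ln y \<and> ln (y + 1) - ln y \<le> 1 / y" if "y > 0" for y :: real
  proof
    have "ln (y / (y + 1)) \<le> y / (y + 1) - 1"
      using that by (intro ln_le_minus_one) auto
    then show "1 / (y + 1) \<le> ln (y + 1) - ln y"
      using that by (simp add: ln_div field_simps)
    have "ln ((y + 1) / y) \<le> (y + 1) / y - 1"
      using that by (intro ln_le_minus_one) auto
    then show "ln (y + 1) - ln y \<le> 1 / y"
      using that by (simp add: ln_div field_simps)
  qed
  from *[of x] *[of "x - 1"] assms
  show "1 / (x + 1) \<le> ln (x + 1) - ln x" "ln (x + 1) - ln x \<le> 1 / x"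
    "1 / x \<le> ln x - ln (x - 1)" "ln x - ln (x - 1) \<le> 1 / (x - 1)"
    by auto
qed

text \<open>Upward and downward steps change the logarithm by about 1 / x, and on the band 1 / x
  differs from 1 / (2\<epsilon> i) by about 2 i^(3/4) / (2\<epsilon> i)^2 = i^(-5/4) /
  (2\<epsilon>^2). The constant in the claim is twice this limit, to leave room for lower-order
  terms.\<close>

lemma band_increments:
  assumes "0 < \<epsilon>"
  shows "\<forall>\<^sub>F i in sequentially. \<forall>x. \<bar>x - 2 * \<epsilon> * real i\<bar> \<le> 2 * real i powr (3 / 4) \<longrightarrow>
    x > 1 \<and>
    \<bar>ln (x + 1) - ln x - (ln (real i + 1) - ln (real i)) / (2 * \<epsilon>)\<bar> \<le> 1 / \<epsilon>\<^sup>2 * real i powr (- 5 / 4) \<and>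
    \<bar>ln x - ln (x - 1) - (ln (real i + 1) - ln (real i)) / (2 * \<epsilon>)\<bar> \<le> 1 / \<epsilon>\<^sup>2 * real i powr (- 5 / 4)"
proof -
  let ?hi = "\<lambda>i. 1 / (2 * \<epsilon> * real i - 2 * real i powr (3 / 4) - 1) - 1 / (2 * \<epsilon>) / (real i + 1)"
  let ?lo = "\<lambda>i. 1 / (2 * \<epsilon>) / real i - 1 / (2 * \<epsilon> * real i + 2 * real i powr (3 / 4) + 1)"
  have lim: "1 / (2 * \<epsilon>\<^sup>2) < 1 / \<epsilon>\<^sup>2"
    using assms by (simp add: field_simps)
  have "(\<lambda>i. ?hi i * real i powr (5 / 4)) \<longlonglongrightarrow> 1 / (2 * \<epsilon>\<^sup>2)"
    using assms by (real_asymp simp: power2_eq_square field_simps)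
  then have hi: "\<forall>\<^sub>F i in sequentially. ?hi i * real i powr (5 / 4) < 1 / \<epsilon>\<^sup>2"
    using lim by (rule order_tendstoD(2))
  have "(\<lambda>i. ?lo i * real i powr (5 / 4)) \<longlonglongrightarrow> 1 / (2 * \<epsilon>\<^sup>2)"
    using assms by (real_asymp simp: power2_eq_square field_simps)
  then have lo: "\<forall>\<^sub>F i in sequentially. ?lo i * real i powr (5 / 4) < 1 / \<epsilon>\<^sup>2"
    using lim by (rule order_tendstoD(2))
  have "\<forall>\<^sub>F i in sequentially. 2 * \<epsilon> * real i - 2 * real i powr (3 / 4) - 1 > 0"
    using assms by real_asymp
  moreover have "\<forall>\<^sub>F i in sequentially. i > (1::nat)"
    by (rule eventually_gt_at_top)
  ultimately show ?thesis
    using hi lo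
  proof eventually_elim
    case (elim i)
    let ?L = "(ln (real i + 1) - ln (real i)) / (2 * \<epsilon>)"
    have inv: "real i powr (- 5 / 4) * real i powr (5 / 4) = 1"
      using elim(2) by (simp add: powr_add [symmetric])
    have cancel: "y \<le> 1 / \<epsilon>\<^sup>2 * real i powr (- 5 / 4)" if "y * real i powr (5 / 4) < 1 / \<epsilon>\<^sup>2" for y
    proof -
      have "y = y * real i powr (5 / 4) * real i powr (- 5 / 4)"
        using inv by (simp only: mult.assoc mult.commute[of "real i powr (5 / 4)"] mult_1_right)
      also have "\<dots> \<le> 1 / \<epsilon>\<^sup>2 * real i powr (- 5 / 4)"
        using that by (intro mult_right_mono) auto
      finally show ?thesis .
    qed
    note err = cancel[OF elim(3)] cancel[OF elim(4)]
    have "1 / (real i + 1) / (2 * \<epsilon>) \<le> ?L \<and> ?L \<le> 1 / real i / (2 * \<epsilon>)"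
      using ln_increment_bounds[of "real i"] elim(2) assms by (intro conjI divide_right_mono) auto
    then have L: "1 / (2 * \<epsilon>) / (real i + 1) \<le> ?L" "?L \<le> 1 / (2 * \<epsilon>) / real i"
      by (simp_all add: mult.commute)
    show ?case
    proof (intro allI impI)
      fix x assume x: "\<bar>x - 2 * \<epsilon> * real i\<bar> \<le> 2 * real i powr (3 / 4)"
      then have x1: "x > 1" using elim(1) by linarith
      have b: "1 / (x - 1) \<le> 1 / (2 * \<epsilon> * real i - 2 * real i powr (3 / 4) - 1)"
        using x elim(1) by (intro divide_left_mono mult_pos_pos) linarith+
      have b': "1 / (2 * \<epsilon> * real i + 2 * real i powr (3 / 4) + 1) \<le> 1 / (x + 1)"
        using x x1 by (intro divide_left_mono mult_pos_pos) linarith+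
      have "1 / (x + 1) \<le> 1 / x" "1 / x \<le> 1 / (x - 1)"
        using x1 by (auto intro!: divide_left_mono)
      with b b' ln_increment_bounds[OF x1] L err x1
      show "x > 1 \<and> \<bar>ln (x + 1) - ln x - ?L\<bar> \<le> 1 / \<epsilon>\<^sup>2 * real i powr (- 5 / 4) \<and>
          \<bar>ln x - ln (x - 1) - ?L\<bar> \<le> 1 / \<epsilon>\<^sup>2 * real i powr (- 5 / 4)"
        by (intro conjI abs_leI) linarith+
    qed
  qed
qed

lemma band_ln:
  assumes "0 < \<epsilon>" "\<tau> > 0"
  shows "\<forall>\<^sub>F i in sequentially. \<forall>x. \<bar>x - 2 * \<epsilon> * real i\<bar> \<le> 2 * real i powr (3 / 4) \<longrightarrow>
    x > 0 \<and> \<bar>ln x - ln (2 * \<epsilon> * real i)\<bar> \<le> \<tau>"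
proof -
  have "(\<lambda>i. ln (2 * \<epsilon> * real i) - ln (2 * \<epsilon> * real i - 2 * real i powr (3 / 4))) \<longlonglongrightarrow> 0"
    using assms by real_asymp
  then have lo: "\<forall>\<^sub>F i in sequentially. ln (2 * \<epsilon> * real i) - ln (2 * \<epsilon> * real i - 2 * real i powr (3 / 4)) < \<tau>"
    using assms(2) by (rule order_tendstoD(2))
  have "(\<lambda>i. ln (2 * \<epsilon> * real i + 2 * real i powr (3 / 4)) - ln (2 * \<epsilon> * real i)) \<longlonglongrightarrow> 0"
    using assms by real_asymp
  then have hi: "\<forall>\<^sub>F i in sequentially. ln (2 * \<epsilon> * real i + 2 * real i powr (3 / 4)) - ln (2 * \<epsilon> * real i) < \<tau>"
    using assms(2) by (rule order_tendstoD(2))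
  have "\<forall>\<^sub>F i in sequentially. 2 * \<epsilon> * real i - 2 * real i powr (3 / 4) > 0"
    using assms by real_asymp
  then show ?thesis
    using lo hi
  proof eventually_elim
    case (elim i)
    show ?case
    proof (intro allI impI)
      fix x assume x: "\<bar>x - 2 * \<epsilon> * real i\<bar> \<le> 2 * real i powr (3 / 4)"
      then have x0: "x > 0" using elim(1) by linarith
      have "ln (2 * \<epsilon> * real i - 2 * real i powr (3 / 4)) \<le> ln x"
        using x elim(1) x0 by (subst ln_le_cancel_iff) linarith+
      moreover have "ln x \<le> ln (2 * \<epsilon> * real i + 2 * real i powr (3 / 4))"
        using x x0 by (subst ln_le_cancel_iff) linarith+
      ultimately show "x > 0 \<and> \<bar>ln x - ln (2 * \<epsilon> * real i)\<bar> \<le> \<tau>"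
        using x0 elim by linarith
    qed
  qed
qed

text \<open>
  A path of the population size enters \<open>surv_mean\<close> through its downward steps only. Splitting its
  logarithm into increments, the sum over the downward steps is half of the total increment minus
  half of the total variation, and on a band every increment has absolute value
  \<open>1 / (2 * \<epsilon> * i)\<close> up to a summable error. Thus no separate control of the
  fluctuations of the removal times is needed.
\<close>

definition typical_index :: "real \<Rightarrow> nat \<Rightarrow> nat \<Rightarrow> real" where
  "typical_index \<epsilon> n s = 2 * \<epsilon> * real n * (real s / real n) powr (birth_prob \<epsilon> / (2 * \<epsilon>))"

lemma surv_mean_typical:
  assumes \<epsilon>: "0 < \<epsilon>" and \<tau>: "\<tau> > 0"
  shows "\<forall>\<^sub>F m in sequentially. \<forall>n. \<forall>\<xi>\<in>band \<epsilon> m n. \<forall>s\<in>{m..n}.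
    exp (- \<tau>) * typical_index \<epsilon> n s \<le> surv_mean \<xi> s n \<and>
    surv_mean \<xi> s n \<le> exp \<tau> * typical_index \<epsilon> n s"
proof -
  let ?err = "\<lambda>i. 1 / \<epsilon>\<^sup>2 * real i powr (- 5 / 4)"
  have "summable ?err"
    by (intro summable_mult) (simp add: summable_real_powr_iff)
  then have "\<forall>\<^sub>F m in sequentially. \<forall>n. sum ?err {m..<n} \<le> \<tau>"
    using \<tau> by (intro summable_tail_small) auto
  moreover have "\<forall>\<^sub>F m in sequentially. m > (0::nat)"
    by (rule eventually_gt_at_top)
  ultimately show ?thesis
    using eventually_all_ge_at_top[OF band_increments[OF \<epsilon>]]
      eventually_all_ge_at_top[OF band_ln[OF \<epsilon> half_gt_zero[OF \<tau>]]]
  proof eventually_elim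
    case (elim m)
    show ?case
    proof (intro allI ballI)
      fix n \<xi> s assume \<xi>: "\<xi> \<in> band \<epsilon> m n" and s: "s \<in> {m..n}"
      let ?x = "\<lambda>i. real (popsize \<xi> i)"
      let ?D = "\<lambda>k. (ln (real k) - ln (real s)) / (2 * \<epsilon>)"
      have band: "\<bar>?x i - 2 * \<epsilon> * real i\<bar> \<le> 2 * real i powr (3 / 4)" if "i \<in> {m..n}" for i
        using \<xi> that by (auto simp: band_def)
      \<comment> \<open>With U and W the total sizes of upward and downward increments of the
        logarithm between \<open>s\<close> and \<open>k\<close>, one has U - W =
        \<open>ln (?x k) - ln (?x s)\<close> and U + W \<approx> \<open>?D k\<close>, while
        \<open>ln (surv_mean \<xi> s k)\<close> is \<open>ln (?x s)\<close> - W. Eliminating U and W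
        gives this formula.\<close>
      have main: "k \<le> n \<longrightarrow> surv_mean \<xi> s k > 0 \<and>
          \<bar>ln (surv_mean \<xi> s k) - (ln (?x s) + ln (?x k) - ?D k) / 2\<bar> \<le> sum ?err {s..<k} / 2"
        if "s \<le> k" for k
        using that
      proof (induction k rule: dec_induct)
        case base
        then show ?case
          using elim(4)[rule_format, of s "?x s"] band[of s] s by (simp add: surv_mean_refl)
      next
        case (step k)
        show ?case
        proof
          assume k: "Suc k \<le> n"
          then have km: "k \<in> {m..n}" using step.hyps s by auto
          have x1: "?x k > 1"
            and inc: "\<bar>ln (?x k + 1) - ln (?x k) - (ln (real k + 1) - ln (real k)) / (2 * \<epsilon>)\<bar> \<le> ?err k"
              "\<bar>ln (?x k) - ln (?x k - 1) - (ln (real k + 1) - ln (real k)) / (2 * \<epsilon>)\<bar> \<le> ?err k"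
            using elim(3)[rule_format, OF _ band[OF km]] km by (blast intro: atLeastAtMost_iff[THEN iffD1, THEN conjunct1])+
          from step.IH k have IH: "surv_mean \<xi> s k > 0"
            "\<bar>ln (surv_mean \<xi> s k) - (ln (?x s) + ln (?x k) - ?D k) / 2\<bar> \<le> sum ?err {s..<k} / 2"
            by auto
          have sum: "sum ?err {s..<Suc k} = sum ?err {s..<k} + ?err k"
            using step.hyps by simp
          have D: "?D (Suc k) = ?D k + (ln (real k + 1) - ln (real k)) / (2 * \<epsilon>)"
            by (simp add: diff_divide_distrib add.commute)
          show "surv_mean \<xi> s (Suc k) > 0 \<and>
            \<bar>ln (surv_mean \<xi> s (Suc k)) - (ln (?x s) + ln (?x (Suc k)) - ?D (Suc k)) / 2\<bar>
              \<le> sum ?err {s..<Suc k} / 2"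
          proof (cases "\<xi> (Suc k)")
            case True
            then have "surv_mean \<xi> s (Suc k) = surv_mean \<xi> s k" "?x (Suc k) = ?x k + 1"
              using step.hyps by (auto simp: surv_mean_Suc)
            then show ?thesis
              unfolding sum D using IH inc(1) by (simp only:) argo
          next
            case False
            have pos: "1 - 1 / ?x k > 0" using x1 by simp
            have mean: "surv_mean \<xi> s (Suc k) = surv_mean \<xi> s k * (1 - 1 / ?x k)"
              using False step.hyps by (simp add: surv_mean_Suc)
            have x: "?x (Suc k) = ?x k - 1" using False x1 by simp
            have "1 - 1 / ?x k = (?x k - 1) / ?x k"
              using x1 by (simp add: field_simps)
            then have "ln (1 - 1 / ?x k) = ln (?x k - 1) - ln (?x k)"
              using x1 by (simp add: ln_div)
            then have "ln (surv_mean \<xi> s (Suc k)) = ln (surv_mean \<xi> s k) + (ln (?x k - 1) - ln (?x k))"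
              unfolding mean using IH(1) pos by (simp only: ln_mult_pos)
            moreover have "surv_mean \<xi> s (Suc k) > 0"
              unfolding mean using IH(1) pos by simp
            ultimately show ?thesis
              unfolding sum D x using IH inc(2) by argo
          qed
        qed
      qed
      let ?t = "typical_index \<epsilon> n s"
      have n: "n \<in> {m..n}" and pos: "real s > 0" "real n > 0" using s elim(2) by auto
      \<comment> \<open>Each endpoint error \<tau>/2 is halved by the formula, and the increments
        contribute another \<tau>/2, so the total is \<tau>. Replacing the sizes by 2\<epsilon> s
        and 2\<epsilon> n yields the exponent 1/2 + 1/(4\<epsilon>) = p / (2\<epsilon>).\<close>
      have "\<bar>ln (?x s) - ln (2 * \<epsilon> * real s)\<bar> \<le> \<tau> / 2" "\<bar>ln (?x n) - ln (2 * \<epsilon> * real n)\<bar> \<le> \<tau> / 2"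
        using elim(4)[rule_format, OF _ band[OF s]] elim(4)[rule_format, OF _ band[OF n]] s n by simp_all
      moreover have "ln ?t = (ln (2 * \<epsilon> * real s) + ln (2 * \<epsilon> * real n) - ?D n) / 2"
        using \<epsilon> pos
        by (simp add: typical_index_def birth_prob_def ln_mult ln_div ln_powr field_simps)
      moreover have "sum ?err {s..<n} \<le> \<tau>"
      proof -
        have "sum ?err {s..<n} \<le> sum ?err {m..<n}"
          using s by (intro sum_mono2) auto
        also have "\<dots> \<le> \<tau>" using elim(1) by simp
        finally show ?thesis .
      qed
      moreover have mu: "surv_mean \<xi> s n > 0"
        "\<bar>ln (surv_mean \<xi> s n) - (ln (?x s) + ln (?x n) - ?D n) / 2\<bar> \<le> sum ?err {s..<n} / 2"
        using main[of n] s by auto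
      ultimately have "\<bar>ln (surv_mean \<xi> s n) - ln ?t\<bar> \<le> \<tau>"
        by argo
      moreover note mu(1)
      moreover have "?t > 0"
        using \<epsilon> pos by (simp add: typical_index_def)
      ultimately show "exp (- \<tau>) * ?t \<le> surv_mean \<xi> s n \<and> surv_mean \<xi> s n \<le> exp \<tau> * ?t"
        by (subst (1 2) ln_le_cancel_iff [symmetric]) (auto simp: ln_mult)
    qed
  qed
qed

section \<open>The failure probability of the coupling\<close>

lemma vertex_index_mono: "finite V \<Longrightarrow> s \<le> t \<Longrightarrow> vertex_index V s \<le> vertex_index V t"
  unfolding vertex_index_def by (intro card_mono) auto

lemma typical_index_pos: "0 < \<epsilon> \<Longrightarrow> 0 < n \<Longrightarrow> 0 < s \<Longrightarrow> 0 < typical_index \<epsilon> n s"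
  by (simp add: typical_index_def)

lemma typical_index_scale:
  assumes "0 < \<epsilon>" "real s' \<le> r * real s" "r \<ge> 0"
  shows "typical_index \<epsilon> n s' \<le> r powr (birth_prob \<epsilon> / (2 * \<epsilon>)) * typical_index \<epsilon> n s"
proof -
  let ?a = "birth_prob \<epsilon> / (2 * \<epsilon>)"
  have a: "?a \<ge> 0" using assms by (simp add: birth_prob_def)
  have "(real s' / real n) powr ?a \<le> (r * (real s / real n)) powr ?a"
    using assms a by (intro powr_mono2) (auto simp: divide_right_mono)
  also have "\<dots> = r powr ?a * (real s / real n) powr ?a"
    by (simp only: powr_mult)
  finally show ?thesis
    using assms unfolding typical_index_def
    by (simp add: mult.left_commute mult_left_mono)
qed

lemma typical_index_mono: "0 < \<epsilon> \<Longrightarrow> s \<le> s' \<Longrightarrow> typical_index \<epsilon> n s \<le> typical_index \<epsilon> n s'"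
  using typical_index_scale[of \<epsilon> s 1 s' n] by simp

text \<open>As a function of the position, \<open>bd_prob\<close> inverts
  \<open>typical_index\<close>: at the typical position of label \<open>j\<close> it equals \<Delta>
  \<beta> / (2\<epsilon> j). The powers of 2\<epsilon> combine to 1 / (2\<epsilon>) because 1 - p +
  2\<epsilon> = p.\<close>

lemma bd_prob_typical_index:
  assumes \<epsilon>: "0 < \<epsilon>" and pos: "0 < j" "0 < n" "0 < k"
  shows "bd_prob \<beta> \<epsilon> \<Delta> n k =
    \<Delta> * (\<beta> / (2 * \<epsilon> * real j)) * (real k / typical_index \<epsilon> n j) powr (- (2 * \<epsilon> / birth_prob \<epsilon>))"
proof -
  let ?p = "birth_prob \<epsilon>" and ?t = "typical_index \<epsilon> n j"
  let ?g = "2 * \<epsilon> / ?p"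
  have p: "?p > 0" using \<epsilon> by (simp add: birth_prob_def)
  have t: "?t > 0" using \<epsilon> pos by (intro typical_index_pos)
  have "?t / real n = 2 * \<epsilon> * (real j / real n) powr (1 / ?g)"
    using pos by (simp add: typical_index_def)
  then have "(?t / real n) powr (- ?g) =
      (2 * \<epsilon>) powr (- ?g) * ((real j / real n) powr (1 / ?g)) powr (- ?g)"
    using \<epsilon> by (simp only: powr_mult)
  also have "((real j / real n) powr (1 / ?g)) powr (- ?g) = real n / real j"
    using \<epsilon> p pos by (simp add: powr_powr powr_minus)
  finally have tn: "(?t / real n) powr (- ?g) = (2 * \<epsilon>) powr (- ?g) * (real n / real j)" .
  have "real k / real n = (real k / ?t) * (?t / real n)"
    using t by simp
  then have kn: "(real k / real n) powr (- ?g) =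
      (real k / ?t) powr (- ?g) * ((2 * \<epsilon>) powr (- ?g) * (real n / real j))"
    using t pos by (simp only: powr_mult tn)
  have "(2 * \<epsilon>) powr (- ((1 - ?p) / ?p)) * (2 * \<epsilon>) powr (- ?g) = (2 * \<epsilon>) powr (- 1)"
  proof -
    have "- ((1 - ?p) / ?p) + (- ?g) = - ((1 - ?p + 2 * \<epsilon>) / ?p)"
      by (simp add: add_divide_distrib)
    also have "1 - ?p + 2 * \<epsilon> = ?p" by (simp add: birth_prob_def)
    finally have "- ((1 - ?p) / ?p) + (- ?g) = - 1" using p by simp
    then show ?thesis by (simp only: powr_add [symmetric])
  qed
  also have "\<dots> = 1 / (2 * \<epsilon>)"
    using \<epsilon> by (simp add: powr_minus_divide)
  finally have const: "(2 * \<epsilon>) powr (- ((1 - ?p) / ?p)) * (2 * \<epsilon>) powr (- ?g) = 1 / (2 * \<epsilon>)" .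
  have "bd_prob \<beta> \<epsilon> \<Delta> n k = \<Delta> * \<beta> * ((2 * \<epsilon>) powr (- ((1 - ?p) / ?p)) * (2 * \<epsilon>) powr (- ?g)) *
      (1 / real n) * ((real k / ?t) powr (- ?g) * (real n / real j))"
    unfolding bd_prob_def Let_def kn by (simp only: mult_ac)
  then show ?thesis
    unfolding const
    using pos by (simp add: field_simps)
qed

text \<open>The exponent 2\<epsilon>/p lies in [0, 1], so an error in the position is not amplified.
  The errors of position and population size together cost at most the factor (1 + \<delta>/4) / (1
  - \<delta>/4), which is at most 1 + \<delta> and has inverse at least 1 - \<delta>.\<close>

lemma edge_prob_sandwich:
  assumes \<epsilon>: "0 < \<epsilon>" "\<epsilon> < 1 / 2" and \<beta>: "\<beta> > 0" and \<delta>: "0 < \<delta>" "\<delta> < 1" and pos: "0 < j" "0 < n"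
    and k: "(1 - \<delta> / 4) * typical_index \<epsilon> n j \<le> real k" "real k \<le> (1 + \<delta> / 4) * typical_index \<epsilon> n j"
    and x: "(1 - \<delta> / 4) * (2 * \<epsilon> * real j) \<le> x" "x \<le> (1 + \<delta> / 4) * (2 * \<epsilon> * real j)"
  shows "bd_prob \<beta> \<epsilon> (1 - \<delta>) n k \<le> \<beta> / x" "\<beta> / x \<le> bd_prob \<beta> \<epsilon> (1 + \<delta>) n k"
proof -
  let ?t = "typical_index \<epsilon> n j" and ?g = "2 * \<epsilon> / birth_prob \<epsilon>"
  let ?d = "\<delta> / 4"
  define b where "b = \<beta> / (2 * \<epsilon> * real j)"
  define y where "y = (real k / ?t) powr (- ?g)"
  have t: "?t > 0" using \<epsilon> pos by (intro typical_index_pos)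
  have "(1 - ?d) * ?t > 0" using t \<delta> by simp
  with k(1) have k0: "0 < k" by (cases "k = 0") auto
  have g: "0 \<le> ?g" "?g \<le> 1" using \<epsilon> by (auto simp: birth_prob_def)
  have r: "1 - ?d \<le> real k / ?t" "real k / ?t \<le> 1 + ?d"
    using k t by (auto simp: field_simps)
  have b: "b > 0" using \<epsilon> \<beta> pos by (simp add: b_def)
  have "y \<le> (1 - ?d) powr (- ?g)"
    unfolding y_def using r \<delta> g by (intro powr_mono2') auto
  also have "\<dots> \<le> (1 - ?d) powr (- 1)"
    using \<delta> g by (intro powr_mono') auto
  finally have y_le: "y \<le> 1 / (1 - ?d)"
    using \<delta> by (simp add: powr_minus_divide)
  have "1 / (1 + ?d) = (1 + ?d) powr (- 1)"
    using \<delta> by (simp add: powr_minus_divide)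
  also have "\<dots> \<le> (1 + ?d) powr (- ?g)"
    using \<delta> g by (intro powr_mono) auto
  also have "\<dots> \<le> y"
    unfolding y_def using r \<delta> g by (intro powr_mono2') auto
  finally have y_ge: "1 / (1 + ?d) \<le> y" .
  have x0: "x > 0"
  proof -
    have "0 < (1 - ?d) * (2 * \<epsilon> * real j)" using \<delta> \<epsilon> pos by simp
    with x(1) show ?thesis by linarith
  qed
  have bd: "bd_prob \<beta> \<epsilon> \<Delta> n k = \<Delta> * b * y" for \<Delta>
    unfolding y_def b_def by (rule bd_prob_typical_index[OF \<epsilon>(1) pos k0])
  have "b * (1 / (1 + ?d)) = \<beta> / ((1 + ?d) * (2 * \<epsilon> * real j))"
    by (simp add: b_def)
  also have "\<dots> \<le> \<beta> / x"
    using x x0 \<beta> \<delta> \<epsilon> pos by (intro divide_left_mono) auto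
  finally have bx: "b * (1 / (1 + ?d)) \<le> \<beta> / x" .
  have "\<beta> / x \<le> \<beta> / ((1 - ?d) * (2 * \<epsilon> * real j))"
    using x x0 \<beta> \<delta> \<epsilon> pos by (intro divide_left_mono) auto
  also have "\<dots> = b * (1 / (1 - ?d))"
    by (simp add: b_def)
  finally have xb: "\<beta> / x \<le> b * (1 / (1 - ?d))" .
  have "(1 - \<delta>) * b * y \<le> (1 - \<delta>) * b * (1 / (1 - ?d))"
    using \<delta> b y_le by (intro mult_left_mono) auto
  also have "\<dots> = b * ((1 - \<delta>) * (1 / (1 - ?d)))" by simp
  also have "\<dots> \<le> b * (1 / (1 + ?d))"
  proof -
    have "(1 - \<delta>) * (1 + ?d) \<le> 1 - ?d"
      using \<delta> by (simp add: algebra_simps)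
    then show ?thesis
      using \<delta> b by (intro mult_left_mono) (auto simp: field_simps)
  qed
  finally show "bd_prob \<beta> \<epsilon> (1 - \<delta>) n k \<le> \<beta> / x"
    unfolding bd using bx by linarith
  have "b * (1 / (1 - ?d)) \<le> b * ((1 + \<delta>) * (1 / (1 + ?d)))"
  proof -
    have "\<delta> * \<delta> \<le> \<delta>" using \<delta> by (simp add: mult_left_le)
    moreover have "(1 + \<delta>) * (1 - ?d) = 1 + 3 / 4 * \<delta> - \<delta> * \<delta> / 4"
      by (simp add: field_simps)
    ultimately have "1 + ?d \<le> (1 + \<delta>) * (1 - ?d)"
      using \<delta> by linarith
    then show ?thesis
      using \<delta> b by (intro mult_left_mono) (auto simp: field_simps)
  qed
  also have "\<dots> = (1 + \<delta>) * b * (1 / (1 + ?d))" by simp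
  also have "\<dots> \<le> (1 + \<delta>) * b * y"
    using \<delta> b y_ge by (intro mult_left_mono) auto
  finally show "\<beta> / x \<le> bd_prob \<beta> \<epsilon> (1 + \<delta>) n k"
    unfolding bd using xb by linarith
qed

text \<open>Actual and typical counts both increase with the label, so control at the two
  neighbouring grid points suffices; moving to a neighbour costs a factor 1 + u. The upper neighbour
  is cut off at \<open>n\<close>, since the moment bounds concern labels up to
  \<open>n\<close>.\<close>

lemma vertex_index_between_grid_points:
  assumes \<epsilon>: "0 < \<epsilon>" and u: "0 < u" "u < 1" and V: "finite V"
    and j: "i ^ A \<le> j" "j \<le> (i + 1) ^ A" "j \<le> n" and i: "1 \<le> i"
    and ratio: "((real (i + 1) / real i) ^ A) powr (birth_prob \<epsilon> / (2 * \<epsilon>)) \<le> 1 + u"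
    and lower: "(1 - u) * exp (- u) * typical_index \<epsilon> n (i ^ A) \<le> real (vertex_index V (i ^ A))"
    and upper: "real (vertex_index V (min ((i + 1) ^ A) n)) \<le>
      (1 + u) * exp u * typical_index \<epsilon> n (min ((i + 1) ^ A) n)"
  shows "(1 - u) * exp (- u) / (1 + u) * typical_index \<epsilon> n j \<le> real (vertex_index V j)"
    and "real (vertex_index V j) \<le> (1 + u)\<^sup>2 * exp u * typical_index \<epsilon> n j"
proof -
  let ?t = "typical_index \<epsilon> n" and ?r = "(real (i + 1) / real i) ^ A"
  have r: "real (i + 1) ^ A = ?r * real i ^ A"
    using i by (simp add: power_divide)
  have nonneg: "?t s \<ge> 0" for s
    using \<epsilon> by (simp add: typical_index_def)
  have scale: "?t s' \<le> (1 + u) * ?t s" if "real s' \<le> ?r * real s" for s s'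
  proof -
    have "?t s' \<le> ?r powr (birth_prob \<epsilon> / (2 * \<epsilon>)) * ?t s"
      using \<epsilon> that by (intro typical_index_scale) auto
    also have "\<dots> \<le> (1 + u) * ?t s"
      by (intro mult_right_mono ratio nonneg)
    finally show ?thesis .
  qed
  have "real j \<le> real (i + 1) ^ A"
    using j(2) by (metis of_nat_le_iff of_nat_power)
  then have tj: "?t j \<le> (1 + u) * ?t (i ^ A)"
    using r by (intro scale) simp
  have "(1 - u) * exp (- u) / (1 + u) * ?t j \<le> (1 - u) * exp (- u) / (1 + u) * ((1 + u) * ?t (i ^ A))"
    using u tj by (intro mult_left_mono) auto
  also have "\<dots> = (1 - u) * exp (- u) * ?t (i ^ A)"
    using u by simp
  also have "\<dots> \<le> real (vertex_index V (i ^ A))" by (rule lower)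
  also have "\<dots> \<le> real (vertex_index V j)"
    using vertex_index_mono[OF V j(1)] by simp
  finally show "(1 - u) * exp (- u) / (1 + u) * ?t j \<le> real (vertex_index V j)" .
  have "real (min ((i + 1) ^ A) n) \<le> real ((i + 1) ^ A)"
    by (simp only: of_nat_le_iff min.cobounded1)
  also have "\<dots> = ?r * real (i ^ A)"
    using r by simp
  also have "\<dots> \<le> ?r * real j"
    using j(1) by (intro mult_left_mono) (simp_all only: of_nat_le_iff, simp)
  finally have "?t (min ((i + 1) ^ A) n) \<le> (1 + u) * ?t j"
    by (rule scale)
  then have "(1 + u) * exp u * ?t (min ((i + 1) ^ A) n) \<le> (1 + u) * exp u * ((1 + u) * ?t j)"
    using u by (intro mult_left_mono) auto
  moreover have "real (vertex_index V j) \<le> real (vertex_index V (min ((i + 1) ^ A) n))"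
    using vertex_index_mono[OF V, of j "min ((i + 1) ^ A) n"] j by simp
  ultimately have "real (vertex_index V j) \<le> (1 + u) * exp u * ((1 + u) * ?t j)"
    using upper by linarith
  then show "real (vertex_index V j) \<le> (1 + u)\<^sup>2 * exp u * ?t j"
    by (simp add: power2_eq_square mult_ac)
qed

lemma card_pairs_le:
  assumes "finite V"
  shows "card {e \<in> pairs V. Max e \<le> s} \<le> (vertex_index V s)\<^sup>2"
proof -
  let ?W = "{u \<in> V. u \<le> s}"
  have "{e \<in> pairs V. Max e \<le> s} \<subseteq> (\<lambda>(u, v). {u, v}) ` (?W \<times> ?W)"
    by (auto simp: pairs_def)
  then have "card {e \<in> pairs V. Max e \<le> s} \<le> card ((\<lambda>(u, v). {u, v}) ` (?W \<times> ?W))"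
    using assms by (intro card_mono) auto
  also have "\<dots> \<le> card (?W \<times> ?W)"
    using assms by (intro card_image_le) auto
  finally show ?thesis
    by (simp add: card_cartesian_product vertex_index_def power2_eq_square)
qed

lemma ex_power_between:
  fixes i\<^sub>0 A j l :: nat
  assumes "i\<^sub>0 ^ A \<le> j" "j < l ^ A"
  shows "\<exists>i\<ge>i\<^sub>0. i < l \<and> i ^ A \<le> j \<and> j \<le> (i + 1) ^ A"
proof -
  have "\<exists>i\<ge>i\<^sub>0. i ^ A \<le> j \<and> j < (i + 1) ^ A"
  proof (rule ccontr)
    assume neg: "\<not> ?thesis"
    have "(i\<^sub>0 + d) ^ A \<le> j" for d
    proof (induction d)
      case (Suc d)
      with neg show ?case by (auto simp: not_less)
    qed (use assms in simp)
    from this[of l] have "(i\<^sub>0 + l) ^ A \<le> j" .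
    moreover have "l ^ A \<le> (i\<^sub>0 + l) ^ A" by (intro power_mono) auto
    ultimately show False using assms(2) by linarith
  qed
  then obtain i where i: "i \<ge> i\<^sub>0" "i ^ A \<le> j" "j < (i + 1) ^ A" by blast
  moreover have "i < l"
  proof (rule ccontr)
    assume "\<not> i < l"
    then have "l ^ A \<le> i ^ A" by (intro power_mono) auto
    with i assms(2) show False by linarith
  qed
  ultimately show ?thesis by (intro exI[of _ i]) auto
qed

text \<open>
  Vertices are counted up to the grid points \<open>min (i ^ A) n\<close>: consecutive powers have ratio close
  to 1, while only about \<open>n powr (1 / A)\<close> of them lie below \<open>n\<close>, so that the
  second-moment bound suffices for a union bound.
\<close>

context
  fixes \<beta> \<epsilon> \<delta> u \<eta> :: real and n s\<^sub>0 s\<^sub>2 i\<^sub>1 l A :: nat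
  assumes \<beta>: "\<beta> > 0" and \<epsilon>: "0 < \<epsilon>" "\<epsilon> < 1 / 2" and \<delta>: "0 < \<delta>" "\<delta> < 1"
    and u: "0 < u" "u < 1" "1 - \<delta> / 4 \<le> (1 - u) * exp (- u) / (1 + u)" "(1 + u)\<^sup>2 * exp u \<le> 1 + \<delta> / 4"
    and typical: "\<And>\<xi> s. \<xi> \<in> band \<epsilon> s\<^sub>0 n \<Longrightarrow> s \<in> {s\<^sub>0..n} \<Longrightarrow>
      exp (- u) * typical_index \<epsilon> n s \<le> surv_mean \<xi> s n \<and>
      surv_mean \<xi> s n \<le> exp u * typical_index \<epsilon> n s"
    and size: "\<And>i x. i \<ge> s\<^sub>0 \<Longrightarrow> \<bar>x - 2 * \<epsilon> * real i\<bar> \<le> 2 * real i powr (3 / 4) \<Longrightarrow>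
      (1 - \<delta> / 4) * (2 * \<epsilon> * real (i + 1)) \<le> x \<and> x \<le> (1 + \<delta> / 4) * (2 * \<epsilon> * real (i + 1))"
    and ratio: "\<And>i. i \<ge> i\<^sub>1 \<Longrightarrow> ((real (i + 1) / real i) ^ A) powr (birth_prob \<epsilon> / (2 * \<epsilon>)) \<le> 1 + u"
    and s\<^sub>0: "0 < s\<^sub>0" "s\<^sub>0 \<le> s\<^sub>2" and i\<^sub>1: "1 \<le> i\<^sub>1" "s\<^sub>2 \<le> i\<^sub>1 ^ A" "i\<^sub>1 ^ A \<le> n" and l: "n < l ^ A"
begin

text \<open>For \<open>i = l\<close> the grid point is \<open>n\<close> itself, because
  \<open>n < l ^ A\<close>; hence every label from \<open>i\<^sub>1 ^ A\<close> to \<open>n\<close>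
  lies between two controlled grid points.\<close>

definition typical_survivors :: "(nat \<Rightarrow> bool) \<Rightarrow> nat set set" where
  "typical_survivors \<xi> = {V. vertex_index V s\<^sub>2 = 0 \<and> (\<forall>i\<in>{i\<^sub>1..l}.
     \<bar>real (vertex_index V (min (i ^ A) n)) - surv_mean \<xi> (min (i ^ A) n) n\<bar> < u * surv_mean \<xi> (min (i ^ A) n) n)}"

lemma grid_point:
  assumes "i \<ge> i\<^sub>1"
  shows "i\<^sub>1 ^ A \<le> min (i ^ A) n" "min (i ^ A) n \<in> {s\<^sub>0..n}"
proof -
  have "i\<^sub>1 ^ A \<le> i ^ A" using assms by (intro power_mono) auto
  then show "i\<^sub>1 ^ A \<le> min (i ^ A) n" "min (i ^ A) n \<in> {s\<^sub>0..n}"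
    using i\<^sub>1 s\<^sub>0 by auto
qed

lemma n_pos: "0 < n"
  using s\<^sub>0 i\<^sub>1 by linarith

lemma typical_survivors_likely:
  assumes \<xi>: "\<xi> \<in> band \<epsilon> s\<^sub>0 n"
  shows "measure_pmf.prob (vset \<xi> n) (- typical_survivors \<xi>) \<le>
    exp u * typical_index \<epsilon> n s\<^sub>2 + real (l + 1) * (exp u / (u\<^sup>2 * typical_index \<epsilon> n (i\<^sub>1 ^ A)))"
proof -
  let ?g = "\<lambda>i. min (i ^ A) n" and ?\<mu> = "\<lambda>s. surv_mean \<xi> s n" and ?t = "typical_index \<epsilon> n"
  let ?F = "\<lambda>i. {V. u * ?\<mu> (?g i) \<le> \<bar>real (vertex_index V (?g i)) - ?\<mu> (?g i)\<bar>}"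
  let ?Z = "{V. vertex_index V s\<^sub>2 \<noteq> 0}"
  have t1: "?t (i\<^sub>1 ^ A) > 0"
    using \<epsilon> n_pos s\<^sub>0 i\<^sub>1 by (intro typical_index_pos) linarith+
  have "measure_pmf.prob (vset \<xi> n) (- typical_survivors \<xi>) \<le>
      measure_pmf.prob (vset \<xi> n) (?Z \<union> (\<Union>i\<in>{i\<^sub>1..l}. ?F i))"
    by (intro measure_pmf.finite_measure_mono) (auto simp: typical_survivors_def not_less)
  also have "\<dots> \<le> measure_pmf.prob (vset \<xi> n) ?Z + measure_pmf.prob (vset \<xi> n) (\<Union>i\<in>{i\<^sub>1..l}. ?F i)"
    by (rule measure_Un_le) auto
  also have "measure_pmf.prob (vset \<xi> n) ?Z \<le> ?\<mu> s\<^sub>2"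
    using i\<^sub>1 by (intro prob_vertex_index_pos) linarith
  also have "?\<mu> s\<^sub>2 \<le> exp u * ?t s\<^sub>2"
    using typical[OF \<xi>, of s\<^sub>2] s\<^sub>0 i\<^sub>1 by simp
  also have "measure_pmf.prob (vset \<xi> n) (\<Union>i\<in>{i\<^sub>1..l}. ?F i) \<le> (\<Sum>i\<in>{i\<^sub>1..l}. measure_pmf.prob (vset \<xi> n) (?F i))"
    by (intro measure_UNION_le) auto
  also have "\<dots> \<le> (\<Sum>i\<in>{i\<^sub>1..l}. exp u / (u\<^sup>2 * ?t (i\<^sub>1 ^ A)))"
  proof (intro sum_mono)
    fix i assume "i \<in> {i\<^sub>1..l}"
    then have g: "i\<^sub>1 ^ A \<le> ?g i" "?g i \<in> {s\<^sub>0..n}"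
      using grid_point by auto
    \<comment> \<open>Typical counts increase along the grid, so the first grid point provides a
      common lower bound for all means in the Chebyshev terms.\<close>
    have "exp (- u) * ?t (i\<^sub>1 ^ A) \<le> exp (- u) * ?t (?g i)"
      using typical_index_mono[OF \<epsilon>(1) g(1)] by (intro mult_left_mono) auto
    also have "\<dots> \<le> ?\<mu> (?g i)"
      using typical[OF \<xi> g(2)] by simp
    finally have \<mu>: "exp (- u) * ?t (i\<^sub>1 ^ A) \<le> ?\<mu> (?g i)" .
    moreover have "exp (- u) * ?t (i\<^sub>1 ^ A) > 0" using t1 by simp
    ultimately have \<mu>0: "?\<mu> (?g i) > 0" by linarith
    have "measure_pmf.prob (vset \<xi> n) (?F i) \<le> 1 / (u\<^sup>2 * ?\<mu> (?g i))"
      using g u \<mu>0 by (intro vertex_index_concentration) auto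
    also have "\<dots> \<le> 1 / (u\<^sup>2 * (exp (- u) * ?t (i\<^sub>1 ^ A)))"
      using \<mu> \<mu>0 t1 u by (intro divide_left_mono mult_left_mono mult_pos_pos) auto
    also have "\<dots> = exp u / (u\<^sup>2 * ?t (i\<^sub>1 ^ A))"
      by (simp add: exp_minus field_simps)
    finally show "measure_pmf.prob (vset \<xi> n) (?F i) \<le> exp u / (u\<^sup>2 * ?t (i\<^sub>1 ^ A))" .
  qed
  also have "\<dots> \<le> real (l + 1) * (exp u / (u\<^sup>2 * ?t (i\<^sub>1 ^ A)))"
    using t1 by (simp only: sum_constant) (intro mult_right_mono, auto)
  finally show ?thesis by simp
qed

lemma vertex_index_typical:
  assumes \<xi>: "\<xi> \<in> band \<epsilon> s\<^sub>0 n" and V: "finite V" "V \<in> typical_survivors \<xi>"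
    and j: "i\<^sub>1 ^ A \<le> j" "j \<le> n"
  shows "(1 - \<delta> / 4) * typical_index \<epsilon> n j \<le> real (vertex_index V j)"
    and "real (vertex_index V j) \<le> (1 + \<delta> / 4) * typical_index \<epsilon> n j"
proof -
  let ?g = "\<lambda>i. min (i ^ A) n" and ?t = "typical_index \<epsilon> n"
  have bounds: "(1 - u) * exp (- u) * ?t (?g i) \<le> real (vertex_index V (?g i)) \<and>
    real (vertex_index V (?g i)) \<le> (1 + u) * exp u * ?t (?g i)" if i: "i \<in> {i\<^sub>1..l}" for i
  proof -
    let ?\<mu> = "surv_mean \<xi> (?g i) n"
    have "\<bar>real (vertex_index V (?g i)) - ?\<mu>\<bar> < u * ?\<mu>"
      using V(2) i by (auto simp: typical_survivors_def)
    then have "(1 - u) * ?\<mu> \<le> real (vertex_index V (?g i))" "real (vertex_index V (?g i)) \<le> (1 + u) * ?\<mu>"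
      by (auto simp: algebra_simps)
    moreover have "exp (- u) * ?t (?g i) \<le> ?\<mu>" "?\<mu> \<le> exp u * ?t (?g i)"
      using typical[OF \<xi> grid_point(2), of i] i by auto
    then have "(1 - u) * (exp (- u) * ?t (?g i)) \<le> (1 - u) * ?\<mu>" "(1 + u) * ?\<mu> \<le> (1 + u) * (exp u * ?t (?g i))"
      using u by (auto intro: mult_left_mono)
    ultimately show ?thesis
      unfolding mult.assoc by linarith
  qed
  have t: "?t j \<ge> 0" using \<epsilon> by (simp add: typical_index_def)
  have "j < l ^ A" using j l by linarith
  with j obtain i where i: "i \<ge> i\<^sub>1" "i < l" "i ^ A \<le> j" "j \<le> (i + 1) ^ A"
    using ex_power_between[of i\<^sub>1 A j l] by blast
  have g: "?g i = i ^ A" using i j by simp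
  have "1 \<le> i" using i i\<^sub>1 by simp
  note between = vertex_index_between_grid_points[OF \<epsilon>(1) u(1,2) V(1) i(3,4) j(2) this ratio[OF i(1)]]
  have "(1 - \<delta> / 4) * ?t j \<le> (1 - u) * exp (- u) / (1 + u) * ?t j"
    by (intro mult_right_mono u t)
  also have "\<dots> \<le> real (vertex_index V j)"
    using bounds[of i] bounds[of "i + 1"] i unfolding g by (intro between) auto
  finally show "(1 - \<delta> / 4) * ?t j \<le> real (vertex_index V j)" .
  have "real (vertex_index V j) \<le> (1 + u)\<^sup>2 * exp u * ?t j"
    using bounds[of i] bounds[of "i + 1"] i unfolding g by (intro between) auto
  also have "\<dots> \<le> (1 + \<delta> / 4) * ?t j"
    by (intro mult_right_mono u t)
  finally show "real (vertex_index V j) \<le> (1 + \<delta> / 4) * ?t j" .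
qed

text \<open>
  The positions of the oldest survivors do not concentrate. The edges at these vertices are
  therefore treated by a first-moment bound: whp they are absent from \<open>G\<^sub>n\<close> and from
  the lower graph, which is enough for both inclusions.
\<close>

lemma failure_sum_le:
  assumes \<xi>: "\<xi> \<in> band \<epsilon> s\<^sub>0 n" and V: "V \<in> set_pmf (vset \<xi> n)" "V \<in> typical_survivors \<xi>"
  shows "(\<Sum>e\<in>pairs V. if bd_edge_prob \<beta> \<epsilon> (1 - \<delta>) n V e \<le> drgvr_edge_prob \<beta> \<xi> e \<and>
        drgvr_edge_prob \<beta> \<xi> e \<le> bd_edge_prob \<beta> \<epsilon> (1 + \<delta>) n V e then 0
      else bd_edge_prob \<beta> \<epsilon> (1 - \<delta>) n V e + drgvr_edge_prob \<beta> \<xi> e)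
    \<le> (2 * typical_index \<epsilon> n (i\<^sub>1 ^ A))\<^sup>2 * (bd_prob \<beta> \<epsilon> 1 n 1 + \<beta> / (\<epsilon> * real s\<^sub>2))"
    (is "(\<Sum>e\<in>_. ?f e) \<le> ?t\<^sup>2 * ?B")
proof -
  let ?a = "bd_edge_prob \<beta> \<epsilon> (1 - \<delta>) n V" and ?b = "drgvr_edge_prob \<beta> \<xi>"
    and ?c = "bd_edge_prob \<beta> \<epsilon> (1 + \<delta>) n V"
  note fin = vset_finite[OF V(1)]
  let ?S = "{e \<in> pairs V. Max e \<le> i\<^sub>1 ^ A}"
  have B: "?B \<ge> 0" using \<beta> \<epsilon> by (simp add: bd_prob_def Let_def)
  have edge: "s\<^sub>2 < Max e" "Max e \<le> n" "1 \<le> vertex_index V (Max e)"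
    "(1 - \<delta> / 4) * (2 * \<epsilon> * real (Max e)) \<le> real (popsize \<xi> (Max e - 1))"
    "real (popsize \<xi> (Max e - 1)) \<le> (1 + \<delta> / 4) * (2 * \<epsilon> * real (Max e))"
    if e: "e \<in> pairs V" for e
  proof -
    from e obtain u v where uv: "e = {u, v}" "u \<in> V" "v \<in> V" "u < v"
      by (auto simp: pairs_def)
    then have [simp]: "Max e = v" by simp
    show "Max e \<le> n" using uv vset_support[OF V(1)] by auto
    have "v \<notin> {w \<in> V. w \<le> s\<^sub>2}"
      using V(2) fin unfolding typical_survivors_def vertex_index_def by auto
    with uv show s2: "s\<^sub>2 < Max e" by auto
    have "{w \<in> V. w \<le> v} \<noteq> {}" using uv by auto
    then show "1 \<le> vertex_index V (Max e)"
      using fin by (simp add: vertex_index_def Suc_le_eq card_gt_0_iff)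
    \<comment> \<open>The strict inequality \<open>s\<^sub>2 < v\<close> makes up for the shift to
      \<open>v - 1\<close>, the time whose population the newborn \<open>v\<close> meets.\<close>
    have vn: "v - 1 \<in> {s\<^sub>0..n}"
      using s2 s\<^sub>0 \<open>Max e \<le> n\<close> by auto
    have "\<bar>real (popsize \<xi> (v - 1)) - 2 * \<epsilon> * real (v - 1)\<bar> \<le> 2 * real (v - 1) powr (3 / 4)"
      using \<xi> vn unfolding band_def by blast
    from size[OF _ this] s2 s\<^sub>0
    show "(1 - \<delta> / 4) * (2 * \<epsilon> * real (Max e)) \<le> real (popsize \<xi> (Max e - 1))"
      "real (popsize \<xi> (Max e - 1)) \<le> (1 + \<delta> / 4) * (2 * \<epsilon> * real (Max e))"
      by auto
  qed
  \<comment> \<open>\<open>bd_prob\<close> decreases with the position, so position 1 is the worst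
    case; the population at the birth of \<open>Max e\<close> is at least \<epsilon>
    \<open>Max e\<close>, where \<open>s\<^sub>2 < Max e\<close>.\<close>
  have old: "?a e + ?b e \<le> ?B" if e: "e \<in> pairs V" for e
  proof (intro add_mono)
    let ?j = "Max e" and ?k = "vertex_index V (Max e)"
    have "?a e \<le> bd_prob \<beta> \<epsilon> (1 - \<delta>) n ?k"
      by (simp add: bd_edge_prob_def)
    also have "\<dots> \<le> bd_prob \<beta> \<epsilon> 1 n 1"
      unfolding bd_prob_def Let_def
      using \<beta> \<delta> \<epsilon> n_pos edge(3)[OF e]
      by (intro mult_mono powr_mono2' divide_right_mono) (auto simp: birth_prob_def)
    finally show "?a e \<le> bd_prob \<beta> \<epsilon> 1 n 1" .
    have "\<epsilon> * real s\<^sub>2 \<le> \<epsilon> * real ?j"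
      using edge(1)[OF e] \<epsilon> by simp
    also have "\<dots> \<le> (1 - \<delta> / 4) * 2 * (\<epsilon> * real ?j)"
      using \<delta> \<epsilon> mult_right_mono[of 1 "(1 - \<delta> / 4) * 2" "\<epsilon> * real ?j"] by simp
    also have "\<dots> \<le> real (popsize \<xi> (?j - 1))"
      using edge(4)[OF e] by (simp only: mult.assoc)
    finally have "\<epsilon> * real s\<^sub>2 \<le> real (popsize \<xi> (?j - 1))" .
    moreover have "\<epsilon> * real s\<^sub>2 > 0"
      using \<epsilon> s\<^sub>0 by simp
    ultimately have "\<beta> / real (popsize \<xi> (?j - 1)) \<le> \<beta> / (\<epsilon> * real s\<^sub>2)"
      using \<beta> by (intro frac_le) auto
    then show "?b e \<le> \<beta> / (\<epsilon> * real s\<^sub>2)"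
      by (simp add: drgvr_edge_prob_def)
  qed
  \<comment> \<open>Here the three probabilities are in order, and truncation at 1 preserves the
    order, so these edges never violate an inclusion.\<close>
  have young: "?f e = 0" if e: "e \<in> pairs V" "\<not> Max e \<le> i\<^sub>1 ^ A" for e
  proof -
    note idx = vertex_index_typical[OF \<xi> fin V(2) _ edge(2)[OF e(1)]]
    have "0 < Max e" using edge(1)[OF e(1)] by simp
    from edge_prob_sandwich[OF \<epsilon> \<beta> \<delta> this n_pos idx edge(4,5)[OF e(1)]] e(2)
    show ?thesis
      by (auto simp: bd_edge_prob_def drgvr_edge_prob_def)
  qed
  have "(\<Sum>e\<in>pairs V. ?f e) = (\<Sum>e\<in>?S. ?f e)"
    using young by (intro sum.mono_neutral_right finite_pairs fin) auto
  also have "\<dots> \<le> (\<Sum>e\<in>?S. ?B)"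
    using old B by (intro sum_mono) auto
  also have "\<dots> = real (card ?S) * ?B"
    by simp
  also have "\<dots> \<le> ?t\<^sup>2 * ?B"
  proof (intro mult_right_mono B)
    have "real (vertex_index V (i\<^sub>1 ^ A)) \<le> (1 + \<delta> / 4) * typical_index \<epsilon> n (i\<^sub>1 ^ A)"
      using \<xi> fin V(2) i\<^sub>1 by (intro vertex_index_typical) auto
    also have "\<dots> \<le> ?t"
      using \<delta> \<epsilon> by (intro mult_right_mono) (auto simp: typical_index_def)
    finally have "(real (vertex_index V (i\<^sub>1 ^ A)))\<^sup>2 \<le> ?t\<^sup>2"
      by (intro power_mono) auto
    moreover have "real (card ?S) \<le> (real (vertex_index V (i\<^sub>1 ^ A)))\<^sup>2"
      using card_pairs_le[OF fin, of "i\<^sub>1 ^ A"] by (metis of_nat_le_iff of_nat_power)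
    ultimately show "real (card ?S) \<le> ?t\<^sup>2" by linarith
  qed
  finally show ?thesis .
qed

text \<open>The three kinds of failure in order: an edge of the lower graph or of
  \<open>G\<^sub>n\<close> inside the old part, atypical survivors given good births, and births
  that leave the band.\<close>

lemma coupling_failure_le:
  "measure_pmf.prob (coupling \<beta> \<epsilon> n \<delta>) {(A, G, B). \<not> (A \<subseteq>\<^sub>G G \<and> G \<subseteq>\<^sub>G B)} \<le>
    (2 * typical_index \<epsilon> n (i\<^sub>1 ^ A))\<^sup>2 * (bd_prob \<beta> \<epsilon> 1 n 1 + \<beta> / (\<epsilon> * real s\<^sub>2)) +
    (exp u * typical_index \<epsilon> n s\<^sub>2 + real (l + 1) * (exp u / (u\<^sup>2 * typical_index \<epsilon> n (i\<^sub>1 ^ A)))) +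
    measure_pmf.prob (births \<epsilon> n) (- band \<epsilon> s\<^sub>0 n)"
  (is "_ \<le> ?x + ?y + _")
proof -
  let ?X = "{(A, G, B). \<not> (A \<subseteq>\<^sub>G G \<and> G \<subseteq>\<^sub>G B)}"
  have t: "typical_index \<epsilon> n s \<ge> 0" for s using \<epsilon> by (simp add: typical_index_def)
  have x: "?x \<ge> 0"
    using \<beta> \<epsilon> by (intro mult_nonneg_nonneg add_nonneg_nonneg) (auto simp: bd_prob_def Let_def)
  have y: "?y \<ge> 0"
    using t u by (intro add_nonneg_nonneg mult_nonneg_nonneg divide_nonneg_nonneg) auto
  show ?thesis
    unfolding coupling_def
  proof (rule prob_bind_pmf_le)
    fix \<xi> assume \<xi>: "\<xi> \<in> band \<epsilon> s\<^sub>0 n"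
    let ?C = "\<lambda>V. couple_subsets (pairs V) (bd_edge_prob \<beta> \<epsilon> (1 - \<delta>) n V) (drgvr_edge_prob \<beta> \<xi>)
      (bd_edge_prob \<beta> \<epsilon> (1 + \<delta>) n V)"
    let ?M = "\<lambda>V. map_pmf (\<lambda>(A, G, B). ((V, A), (V, G), (V, B))) (?C V)"
    have "measure_pmf.prob (bind_pmf (vset \<xi> n) ?M) ?X \<le>
        ?x + measure_pmf.prob (vset \<xi> n) (- typical_survivors \<xi>)"
    proof (rule prob_bind_pmf_le)
      fix V assume V: "V \<in> set_pmf (vset \<xi> n)" "V \<in> typical_survivors \<xi>"
      have "measure_pmf.prob (?M V) ?X = measure_pmf.prob (?C V) {(A, G, B). \<not> (A \<subseteq> G \<and> G \<subseteq> B)}"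
        unfolding measure_map_pmf
        by (rule arg_cong[of _ _ "measure_pmf.prob (?C V)"]) (auto simp: subgraph_def)
      also have "\<dots> \<le> (\<Sum>e\<in>pairs V. if bd_edge_prob \<beta> \<epsilon> (1 - \<delta>) n V e \<le> drgvr_edge_prob \<beta> \<xi> e \<and>
          drgvr_edge_prob \<beta> \<xi> e \<le> bd_edge_prob \<beta> \<epsilon> (1 + \<delta>) n V e then 0
          else bd_edge_prob \<beta> \<epsilon> (1 - \<delta>) n V e + drgvr_edge_prob \<beta> \<xi> e)"
        using \<beta> \<delta> drgvr_edge_prob_unit[of \<beta> \<xi>] bd_edge_prob_unit[of \<beta> _ \<epsilon> n V]
        by (intro couple_subsets_failure finite_pairs vset_finite[OF V(1)]) auto
      also have "\<dots> \<le> ?x"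
        by (rule failure_sum_le[OF \<xi> V])
      finally show "measure_pmf.prob (?M V) ?X \<le> ?x" .
    qed (rule x)
    also have "\<dots> \<le> ?x + ?y"
      using typical_survivors_likely[OF \<xi>] by simp
    finally show "measure_pmf.prob (bind_pmf (vset \<xi> n) ?M) ?X \<le> ?x + ?y" .
  qed (use x y in linarith)
qed

end

section \<open>Choice of the parameters and passage to the limit\<close>

lemma ex_tolerance:
  assumes "0 < (\<delta>::real)"
  shows "\<exists>u. 0 < u \<and> u < 1 \<and> 1 - \<delta> \<le> (1 - u) * exp (- u) / (1 + u) \<and> (1 + u)\<^sup>2 * exp u \<le> 1 + \<delta>"
proof -
  have "((\<lambda>u::real. (1 - u) * exp (- u) / (1 + u)) \<longlongrightarrow> 1) (at_right 0)"
    by real_asymp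
  then have "\<forall>\<^sub>F u in at_right 0. 1 - \<delta> < (1 - u) * exp (- u) / (1 + u)"
    using assms by (intro order_tendstoD(1)) auto
  moreover have "((\<lambda>u::real. (1 + u)\<^sup>2 * exp u) \<longlongrightarrow> 1) (at_right 0)"
    by real_asymp
  then have "\<forall>\<^sub>F u in at_right 0. (1 + u)\<^sup>2 * exp u < 1 + \<delta>"
    using assms by (intro order_tendstoD(2)) auto
  moreover have "\<forall>\<^sub>F u in at_right (0::real). 0 < u \<and> u < 1"
    using eventually_at_right_real[of 0 "1::real"] by simp
  ultimately have "\<forall>\<^sub>F u in at_right 0. 0 < u \<and> u < 1 \<and>
      1 - \<delta> \<le> (1 - u) * exp (- u) / (1 + u) \<and> (1 + u)\<^sup>2 * exp u \<le> 1 + \<delta>"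
    by eventually_elim auto
  then show ?thesis
    by (rule eventually_happens'[OF trivial_limit_at_right_real])
qed

text \<open>The index \<open>i + 1\<close> is the label of a vertex that meets the population of
  time \<open>i\<close>.\<close>

lemma band_relative:
  assumes "0 < \<epsilon>" "0 < \<delta>"
  shows "\<forall>\<^sub>F i in sequentially. \<forall>x. \<bar>x - 2 * \<epsilon> * real i\<bar> \<le> 2 * real i powr (3 / 4) \<longrightarrow>
    (1 - \<delta>) * (2 * \<epsilon> * real (i + 1)) \<le> x \<and> x \<le> (1 + \<delta>) * (2 * \<epsilon> * real (i + 1))"
proof -
  have "\<forall>\<^sub>F i in sequentially. 2 * real i powr (3 / 4) + 2 * \<epsilon> \<le> \<delta> * (2 * \<epsilon> * real i)"
    using assms by real_asymp
  then show ?thesis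
  proof eventually_elim
    case (elim i)
    have "\<delta> * (2 * \<epsilon>) \<ge> 0" using assms by simp
    moreover have "(1 + \<delta>) * (2 * \<epsilon> * real (i + 1)) =
        2 * \<epsilon> * real i + 2 * \<epsilon> + \<delta> * (2 * \<epsilon> * real i) + \<delta> * (2 * \<epsilon>)"
      "(1 - \<delta>) * (2 * \<epsilon> * real (i + 1)) =
        2 * \<epsilon> * real i + 2 * \<epsilon> - \<delta> * (2 * \<epsilon> * real i) - \<delta> * (2 * \<epsilon>)"
      by (simp_all add: algebra_simps)
    ultimately show ?case
      using elim assms(1) by (auto simp: abs_le_iff)
  qed
qed

lemma consecutive_powers_ratio:
  assumes "u > 0"
  shows "\<forall>\<^sub>F i in sequentially. ((real (i + 1) / real i) ^ A) powr c \<le> 1 + u"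
proof -
  have "(\<lambda>i. real (i + 1) / real i) \<longlonglongrightarrow> 1"
    by real_asymp
  then have "(\<lambda>i. ((real (i + 1) / real i) ^ A) powr c) \<longlonglongrightarrow> (1 ^ A) powr c"
    by (intro tendsto_intros) auto
  then have "\<forall>\<^sub>F i in sequentially. ((real (i + 1) / real i) ^ A) powr c < 1 + u"
    using assms by (intro order_tendstoD(2)) auto
  then show ?thesis
    by eventually_elim simp
qed

text \<open>For a prescribed error \<open>y\<close>, the births get the fixed share y/2 through a
  starting time \<open>s\<^sub>0\<close> independent of \<open>n\<close>; all other terms are
  bounded by negative powers of \<open>n\<close>.\<close>

lemma coupling_failure_tendsto_0:
  assumes \<beta>: "\<beta> > 0" and \<epsilon>: "0 < \<epsilon>" "\<epsilon> < 1 / 2" and \<delta>: "0 < \<delta>" "\<delta> < 1"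
  shows "(\<lambda>n. measure_pmf.prob (coupling \<beta> \<epsilon> n \<delta>) {(A, G, B). \<not> (A \<subseteq>\<^sub>G G \<and> G \<subseteq>\<^sub>G B)}) \<longlonglongrightarrow> 0"
    (is "?P \<longlonglongrightarrow> 0")
proof -
  obtain u where u: "0 < u" "u < 1" "1 - \<delta> / 4 \<le> (1 - u) * exp (- u) / (1 + u)"
      "(1 + u)\<^sup>2 * exp u \<le> 1 + \<delta> / 4"
    using ex_tolerance[of "\<delta> / 4"] \<delta> by auto
  define a where "a = birth_prob \<epsilon> / (2 * \<epsilon>)"
  \<comment> \<open>The grid starts at about \<open>n powr \<theta>\<close>, chosen such that \<open>n powr (\<kappa> / 8)\<close> survivors are
    expected up to there: enough for concentration, while \<open>n powr (\<kappa> / 4)\<close> pairs of old survivors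
    still carry no edge, since whp no vertex up to \<open>n powr (\<kappa> / 2)\<close> survives.\<close>
  define \<kappa> where "\<kappa> = 1 - 1 / a"
  define \<theta> where "\<theta> = 1 - (1 - \<kappa>) * (1 - \<kappa> / 8)"
  have a: "a > 1" using \<epsilon> by (simp add: a_def birth_prob_def)
  then have \<kappa>: "0 < \<kappa>" "\<kappa> < 1" by (auto simp: \<kappa>_def)
  have a\<kappa>: "a * (1 - \<kappa>) = 1" using a by (simp add: \<kappa>_def)
  have \<theta>: "\<kappa> \<le> \<theta>" "\<theta> < 1"
  proof -
    have "\<theta> = \<kappa> + (1 - \<kappa>) * \<kappa> / 8" by (simp add: \<theta>_def field_simps)
    moreover have "(1 - \<kappa>) * \<kappa> / 8 \<ge> 0" using \<kappa> by simp
    ultimately show "\<kappa> \<le> \<theta>" by linarith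
    have "(1 - \<kappa>) * (1 - \<kappa> / 8) > 0" using \<kappa> by simp
    then show "\<theta> < 1" by (simp add: \<theta>_def)
  qed
  have a\<theta>: "1 + a * (\<theta> - 1) = \<kappa> / 8"
  proof -
    have "a * (\<theta> - 1) = - (a * (1 - \<kappa>)) * (1 - \<kappa> / 8)" by (simp add: \<theta>_def)
    then show ?thesis by (simp add: a\<kappa>)
  qed
  \<comment> \<open>The grid has about n^(1/A) points, fewer than n^(\<kappa>/16) up to constants,
    while each Chebyshev term is of order n^(-\<kappa>/8). The union bound therefore leaves
    n^(-\<kappa>/16).\<close>
  obtain A :: nat where A: "16 / \<kappa> < real A"
    using reals_Archimedean2 by blast
  then have A0: "A > 0" using \<kappa> by (cases "A = 0") (auto simp: field_simps)
  have A_inv: "1 / real A \<le> \<kappa> / 16"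
    using A A0 \<kappa> by (simp add: field_simps)
  \<comment> \<open>Rounding up gives \<open>i\<^sub>1 n ^ A\<close> at least n^\<theta>; rounding
    down and adding 1 gives \<open>l n ^ A > n\<close>, so the grid passes \<open>n\<close>.\<close>
  define i\<^sub>1 where "i\<^sub>1 n = nat \<lceil>real n powr (\<theta> / real A)\<rceil>" for n
  define s\<^sub>2 where "s\<^sub>2 n = nat \<lfloor>real n powr (\<kappa> / 2)\<rfloor>" for n
  define l where "l n = nat \<lfloor>real n powr (1 / real A)\<rfloor> + 1" for n
  have i\<^sub>1: "real n powr (\<theta> / real A) \<le> real (i\<^sub>1 n)" for n
    unfolding i\<^sub>1_def by (rule real_nat_ceiling_ge)
  have i\<^sub>1': "real (i\<^sub>1 n) \<le> 2 * real n powr (\<theta> / real A)" if "n \<ge> 1" for n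
  proof -
    have "1 \<le> real n powr (\<theta> / real A)"
      using that \<theta> \<kappa> by (intro ge_one_powr_ge_zero) auto
    then show ?thesis unfolding i\<^sub>1_def by linarith
  qed
  have powA: "(real n powr (c / real A)) ^ A = real n powr c" if "n \<ge> 1" for n c
    using that A0 by (simp add: powr_realpow [symmetric] powr_powr)
  have i\<^sub>1A: "real n powr \<theta> \<le> real (i\<^sub>1 n ^ A)" "real (i\<^sub>1 n ^ A) \<le> 2 ^ A * real n powr \<theta>" if "n \<ge> 1" for n
    using power_mono[OF i\<^sub>1[of n], of A] power_mono[OF i\<^sub>1'[OF that], of A]
    by (simp_all add: powA[OF that] power_mult_distrib)
  have s\<^sub>2: "real n powr (\<kappa> / 2) / 2 \<le> real (s\<^sub>2 n)" "real (s\<^sub>2 n) \<le> real n powr (\<kappa> / 2)" if "n \<ge> 1" for n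
  proof -
    have one: "1 \<le> real n powr (\<kappa> / 2)"
      using that \<kappa> by (intro ge_one_powr_ge_zero) auto
    then have "1 \<le> \<lfloor>real n powr (\<kappa> / 2)\<rfloor>"
      by (simp add: le_floor_iff)
    then show "real n powr (\<kappa> / 2) / 2 \<le> real (s\<^sub>2 n)"
      unfolding s\<^sub>2_def by linarith
    from one show "real (s\<^sub>2 n) \<le> real n powr (\<kappa> / 2)"
      unfolding s\<^sub>2_def by linarith
  qed
  have lA: "n < l n ^ A" if "n \<ge> 1" for n
  proof -
    have "real n powr (1 / real A) < real (l n)" unfolding l_def by linarith
    then have "(real n powr (1 / real A)) ^ A < real (l n) ^ A"
      using A0 by (intro power_strict_mono) auto
    then have "real n < real (l n ^ A)" using that by (simp add: powA)
    then show ?thesis by (simp only: of_nat_less_iff)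
  qed
  have l: "real (l n + 1) \<le> 3 * real n powr (\<kappa> / 16)" if "n \<ge> 1" for n
  proof -
    have "1 \<le> real n powr (\<kappa> / 16)"
      using that \<kappa> by (intro ge_one_powr_ge_zero) auto
    moreover have "real n powr (1 / real A) \<le> real n powr (\<kappa> / 16)"
      using that A_inv by (intro powr_mono) auto
    moreover have "real (l n) \<le> real n powr (1 / real A) + 1"
      unfolding l_def by simp
    ultimately show ?thesis by simp
  qed
  let ?t = "typical_index \<epsilon>"
  define K where "K = 2 * \<epsilon> * (2 ^ A) powr a"
  define C where "C = \<beta> * (2 * \<epsilon>) powr (- ((1 - birth_prob \<epsilon>) / birth_prob \<epsilon>))"
  have K: "K > 0" and C: "C > 0" using \<epsilon> \<beta> by (auto simp: K_def C_def)
  have t: "?t n s = 2 * \<epsilon> * real n * (real s / real n) powr a" for n s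
    by (simp add: typical_index_def a_def)
  have t_powr: "2 * \<epsilon> * real n * (c * real n powr b / real n) powr a =
      2 * \<epsilon> * c powr a * real n powr (1 + a * (b - 1))" if "n \<ge> 1" for n b c
  proof -
    have "c * real n powr b / real n = c * real n powr (b - 1)"
      using that by (simp add: powr_diff)
    then have "(c * real n powr b / real n) powr a = c powr a * real n powr (a * (b - 1))"
      by (simp only: powr_mult powr_powr mult.commute[of a])
    then show ?thesis
      using that by (simp add: powr_add)
  qed
  have t_upper: "?t n (i\<^sub>1 n ^ A) \<le> K * real n powr (\<kappa> / 8)" if "n \<ge> 1" for n
  proof -
    have "?t n (i\<^sub>1 n ^ A) \<le> 2 * \<epsilon> * real n * (2 ^ A * real n powr \<theta> / real n) powr a"
      unfolding t using i\<^sub>1A[OF that] \<epsilon> a by (intro mult_left_mono powr_mono2 divide_right_mono) auto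
    then show ?thesis unfolding t_powr[OF that] a\<theta> K_def .
  qed
  have t_lower: "2 * \<epsilon> * real n powr (\<kappa> / 8) \<le> ?t n (i\<^sub>1 n ^ A)" if "n \<ge> 1" for n
  proof -
    have "2 * \<epsilon> * real n * (1 * real n powr \<theta> / real n) powr a \<le> ?t n (i\<^sub>1 n ^ A)"
      unfolding t using i\<^sub>1A[OF that] \<epsilon> a by (intro mult_left_mono powr_mono2 divide_right_mono) auto
    then show ?thesis unfolding t_powr[OF that] a\<theta> by simp
  qed
  have t_s\<^sub>2: "?t n (s\<^sub>2 n) \<le> 2 * \<epsilon> * real n powr (- (a * \<kappa> / 2))" if "n \<ge> 1" for n
  proof -
    have "?t n (s\<^sub>2 n) \<le> 2 * \<epsilon> * real n * (1 * real n powr (\<kappa> / 2) / real n) powr a"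
      unfolding t using s\<^sub>2[OF that] \<epsilon> a by (intro mult_left_mono powr_mono2 divide_right_mono) auto
    moreover have "1 + a * (\<kappa> / 2 - 1) = - (a * \<kappa> / 2)"
      using a\<kappa> by (simp add: algebra_simps)
    ultimately show ?thesis by (simp only: t_powr[OF that]) simp
  qed
  have bd1: "bd_prob \<beta> \<epsilon> 1 n 1 = C * real n powr (- \<kappa>)" if "n \<ge> 1" for n
  proof -
    have exponent: "2 * \<epsilon> / birth_prob \<epsilon> = 1 - \<kappa>" using a by (simp add: \<kappa>_def a_def)
    have "(real 1 / real n) powr (- (2 * \<epsilon> / birth_prob \<epsilon>)) = real n powr (1 - \<kappa>)"
    proof -
      have "real 1 / real n = real n powr (- 1)" using that by (simp add: powr_minus_divide)
      then have "(real 1 / real n) powr (- (1 - \<kappa>)) = real n powr (- 1 * - (1 - \<kappa>))"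
        by (simp only: powr_powr)
      then show ?thesis unfolding exponent by simp
    qed
    then show ?thesis
      unfolding bd_prob_def Let_def C_def using that by (simp add: powr_diff powr_minus divide_inverse)
  qed
  \<comment> \<open>\<open>H\<close> collects everything except the births. Its four summands have
    the exponents -3\<kappa>/4, -\<kappa>/4, -a\<kappa>/2 and -\<kappa>/16.\<close>
  define H where "H n = (2 * (K * real n powr (\<kappa> / 8)))\<^sup>2 * (C * real n powr (- \<kappa>) + 2 * \<beta> / \<epsilon> * real n powr (- (\<kappa> / 2))) +
      (exp u * (2 * \<epsilon> * real n powr (- (a * \<kappa> / 2))) +
       3 * real n powr (\<kappa> / 16) * (exp u / (u\<^sup>2 * (2 * \<epsilon> * real n powr (\<kappa> / 8)))))" for n :: nat
  have H: "H \<longlonglongrightarrow> 0"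
  proof -
    have decay: "(\<lambda>n. c * real n powr (- b)) \<longlonglongrightarrow> 0" if "b > 0" for b c
      using that by real_asymp
    have "a * \<kappa> / 2 > 0" using a \<kappa> by simp
    then have lim: "(\<lambda>n. (4 * K\<^sup>2 * C) * real n powr (- (3 * \<kappa> / 4)) + (8 * K\<^sup>2 * \<beta> / \<epsilon>) * real n powr (- (\<kappa> / 4)) +
        ((exp u * 2 * \<epsilon>) * real n powr (- (a * \<kappa> / 2)) +
         (3 * exp u / (u\<^sup>2 * (2 * \<epsilon>))) * real n powr (- (\<kappa> / 16)))) \<longlonglongrightarrow> 0 + 0 + (0 + 0)"
      using \<kappa> by (intro tendsto_add decay) auto
    have eq: "H n = (4 * K\<^sup>2 * C) * real n powr (- (3 * \<kappa> / 4)) + (8 * K\<^sup>2 * \<beta> / \<epsilon>) * real n powr (- (\<kappa> / 4)) +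
        ((exp u * 2 * \<epsilon>) * real n powr (- (a * \<kappa> / 2)) +
         (3 * exp u / (u\<^sup>2 * (2 * \<epsilon>))) * real n powr (- (\<kappa> / 16)))" for n
    proof -
      let ?w = "\<lambda>c. real n powr c"
      have sq: "(?w (\<kappa> / 8))\<^sup>2 = ?w (\<kappa> / 4)"
        by (simp add: power2_eq_square powr_add [symmetric])
      have prods: "?w (\<kappa> / 4) * ?w (- \<kappa>) = ?w (- (3 * \<kappa> / 4))"
        "?w (\<kappa> / 4) * ?w (- (\<kappa> / 2)) = ?w (- (\<kappa> / 4))" "?w (\<kappa> / 16) / ?w (\<kappa> / 8) = ?w (- (\<kappa> / 16))"
        by (simp_all add: powr_add [symmetric] powr_diff [symmetric])
      have "H n = (4 * K\<^sup>2 * C) * (?w (\<kappa> / 4) * ?w (- \<kappa>)) + (8 * K\<^sup>2 * \<beta> / \<epsilon>) * (?w (\<kappa> / 4) * ?w (- (\<kappa> / 2))) +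
        ((exp u * 2 * \<epsilon>) * ?w (- (a * \<kappa> / 2)) + (3 * exp u / (u\<^sup>2 * (2 * \<epsilon>))) * (?w (\<kappa> / 16) / ?w (\<kappa> / 8)))"
        unfolding H_def power_mult_distrib sq by (simp add: algebra_simps)
      then show ?thesis unfolding prods .
    qed
    from lim show ?thesis unfolding eq [symmetric] by simp
  qed
  show ?thesis
  proof (rule order_tendstoI)
    fix y :: real assume "y < 0"
    then show "\<forall>\<^sub>F n in sequentially. y < ?P n"
      by (intro always_eventually allI) (rule less_le_trans[OF _ measure_nonneg])
  next
    fix y :: real assume y: "0 < y"
    \<comment> \<open>All these bounds are uniform in \<open>n\<close>, so one
      \<open>s\<^sub>0\<close> can be fixed before \<open>n\<close> grows.\<close>
    have "\<forall>\<^sub>F s in sequentially. s > 0 \<and>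
        (\<forall>n. measure_pmf.prob (births \<epsilon> n) (- band \<epsilon> s n) \<le> y / 2) \<and>
        (\<forall>n. \<forall>\<xi>\<in>band \<epsilon> s n. \<forall>s'\<in>{s..n}. exp (- u) * ?t n s' \<le> surv_mean \<xi> s' n \<and>
          surv_mean \<xi> s' n \<le> exp u * ?t n s') \<and>
        (\<forall>i\<ge>s. \<forall>x. \<bar>x - 2 * \<epsilon> * real i\<bar> \<le> 2 * real i powr (3 / 4) \<longrightarrow>
          (1 - \<delta> / 4) * (2 * \<epsilon> * real (i + 1)) \<le> x \<and> x \<le> (1 + \<delta> / 4) * (2 * \<epsilon> * real (i + 1)))"
      using \<epsilon> y \<delta> u
      by (intro eventually_conj eventually_gt_at_top band_likely surv_mean_typical
          eventually_all_ge_at_top band_relative) auto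
    then obtain s\<^sub>0 where s\<^sub>0: "s\<^sub>0 > 0" "\<And>n. measure_pmf.prob (births \<epsilon> n) (- band \<epsilon> s\<^sub>0 n) \<le> y / 2"
      and typical: "\<And>n \<xi> s. \<xi> \<in> band \<epsilon> s\<^sub>0 n \<Longrightarrow> s \<in> {s\<^sub>0..n} \<Longrightarrow>
        exp (- u) * ?t n s \<le> surv_mean \<xi> s n \<and> surv_mean \<xi> s n \<le> exp u * ?t n s"
      and size: "\<And>i x. i \<ge> s\<^sub>0 \<Longrightarrow> \<bar>x - 2 * \<epsilon> * real i\<bar> \<le> 2 * real i powr (3 / 4) \<Longrightarrow>
        (1 - \<delta> / 4) * (2 * \<epsilon> * real (i + 1)) \<le> x \<and> x \<le> (1 + \<delta> / 4) * (2 * \<epsilon> * real (i + 1))"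
      using eventually_happens'[OF sequentially_bot] by (smt (verit))
    obtain i\<^sub>0 where i\<^sub>0: "\<And>i. i \<ge> i\<^sub>0 \<Longrightarrow> ((real (i + 1) / real i) ^ A) powr a \<le> 1 + u"
      using consecutive_powers_ratio[OF u(1)] unfolding eventually_sequentially by blast
    have "\<forall>\<^sub>F n in sequentially. real s\<^sub>0 \<le> real n powr (\<kappa> / 2) / 2"
      using \<kappa> by real_asymp
    moreover have "\<forall>\<^sub>F n in sequentially. real (max 1 i\<^sub>0) \<le> real n powr (\<theta> / real A)"
    proof -
      have "\<theta> / real A > 0" using \<theta> \<kappa> A0 by simp
      then show ?thesis by real_asymp
    qed
    moreover have "\<forall>\<^sub>F n in sequentially. 2 ^ A * real n powr \<theta> \<le> real n"
    proof -
      have "(\<lambda>n. real n powr (\<theta> - 1)) \<longlonglongrightarrow> 0"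
        using \<theta> by real_asymp
      then have "\<forall>\<^sub>F n in sequentially. real n powr (\<theta> - 1) < 1 / 2 ^ A"
        by (rule order_tendstoD(2)) simp
      then show ?thesis
        using eventually_gt_at_top[of 0]
        by eventually_elim (simp add: powr_diff field_simps)
    qed
    moreover have "\<forall>\<^sub>F n in sequentially. H n < y / 2"
      using H y by (intro order_tendstoD(2)) auto
    moreover have "\<forall>\<^sub>F n in sequentially. n \<ge> (1::nat)"
      by (rule eventually_ge_at_top)
    ultimately show "\<forall>\<^sub>F n in sequentially. ?P n < y"
    proof eventually_elim
      case (elim n)
      note n = elim(5)
      have "real s\<^sub>0 \<le> real (s\<^sub>2 n)" using elim(1) s\<^sub>2(1)[OF n] by linarith
      then have s: "s\<^sub>0 \<le> s\<^sub>2 n" by simp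
      have "real (max 1 i\<^sub>0) \<le> real (i\<^sub>1 n)" using elim(2) i\<^sub>1[of n] by linarith
      then have i: "1 \<le> i\<^sub>1 n" "i\<^sub>0 \<le> i\<^sub>1 n" by (simp_all only: of_nat_le_iff max.bounded_iff)
      have "real n powr (\<kappa> / 2) \<le> real n powr \<theta>" using n \<theta> \<kappa> by (intro powr_mono) auto
      then have "real (s\<^sub>2 n) \<le> real (i\<^sub>1 n ^ A)" using s\<^sub>2(2)[OF n] i\<^sub>1A(1)[OF n] by linarith
      then have si: "s\<^sub>2 n \<le> i\<^sub>1 n ^ A" by (simp only: of_nat_le_iff)
      have "real (i\<^sub>1 n ^ A) \<le> real n" using elim(3) i\<^sub>1A(2)[OF n] by linarith
      then have in': "i\<^sub>1 n ^ A \<le> n" by (simp only: of_nat_le_iff)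
      have ratio: "((real (i + 1) / real i) ^ A) powr (birth_prob \<epsilon> / (2 * \<epsilon>)) \<le> 1 + u"
        if "i \<ge> i\<^sub>1 n" for i
        using i\<^sub>0[of i] that i by (simp add: a_def)
      have pos: "real n powr c > 0" for c using n by simp
      have t0: "0 \<le> ?t n s" for s using \<epsilon> by (simp add: typical_index_def)
      have "?P n \<le> (2 * ?t n (i\<^sub>1 n ^ A))\<^sup>2 * (bd_prob \<beta> \<epsilon> 1 n 1 + \<beta> / (\<epsilon> * real (s\<^sub>2 n))) +
          (exp u * ?t n (s\<^sub>2 n) + real (l n + 1) * (exp u / (u\<^sup>2 * ?t n (i\<^sub>1 n ^ A)))) +
          measure_pmf.prob (births \<epsilon> n) (- band \<epsilon> s\<^sub>0 n)"
        by (rule coupling_failure_le[OF \<beta> \<epsilon> \<delta> u typical size ratio s\<^sub>0(1) s i(1) si in' lA[OF n]])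
      also have "\<dots> \<le> H n + y / 2"
      proof (unfold H_def, intro add_mono s\<^sub>0(2) mult_mono)
        show "(2 * ?t n (i\<^sub>1 n ^ A))\<^sup>2 \<le> (2 * (K * real n powr (\<kappa> / 8)))\<^sup>2"
          using t_upper[OF n] t0 by (intro power_mono) auto
        show "bd_prob \<beta> \<epsilon> 1 n 1 \<le> C * real n powr (- \<kappa>)" using bd1[OF n] by simp
        show "0 \<le> bd_prob \<beta> \<epsilon> 1 n 1 + \<beta> / (\<epsilon> * real (s\<^sub>2 n))"
          using bd1[OF n] C \<beta> \<epsilon> by simp
        have "\<beta> / (\<epsilon> * real (s\<^sub>2 n)) \<le> \<beta> / (\<epsilon> * (real n powr (\<kappa> / 2) / 2))"
          using s\<^sub>2(1)[OF n] s s\<^sub>0(1) \<beta> \<epsilon> pos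
          by (intro divide_left_mono mult_left_mono mult_pos_pos) auto
        also have "\<dots> = 2 * \<beta> / \<epsilon> * real n powr (- (\<kappa> / 2))"
          using \<epsilon> by (simp add: powr_minus field_simps)
        finally show "\<beta> / (\<epsilon> * real (s\<^sub>2 n)) \<le> 2 * \<beta> / \<epsilon> * real n powr (- (\<kappa> / 2))" .
        show "?t n (s\<^sub>2 n) \<le> 2 * \<epsilon> * real n powr (- (a * \<kappa> / 2))" by (rule t_s\<^sub>2[OF n])
        show "real (l n + 1) \<le> 3 * real n powr (\<kappa> / 16)" by (rule l[OF n])
        show "exp u / (u\<^sup>2 * ?t n (i\<^sub>1 n ^ A)) \<le> exp u / (u\<^sup>2 * (2 * \<epsilon> * real n powr (\<kappa> / 8)))"
        proof (intro divide_left_mono mult_left_mono mult_pos_pos)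
          have "0 < 2 * \<epsilon> * real n powr (\<kappa> / 8)" using \<epsilon> pos by simp
          with t_lower[OF n] show "0 < ?t n (i\<^sub>1 n ^ A)" by linarith
        qed (use u t_lower[OF n] \<epsilon> pos in auto)
        show "0 \<le> exp u / (u\<^sup>2 * ?t n (i\<^sub>1 n ^ A))" using t0 by simp
      qed (use t0 in auto)
      finally show "?P n < y" using elim(4) by linarith
    qed
  qed
qed

text \<open>At time \<open>n\<close> the sequence uses the finest tolerance 1 / (k + 2) whose
  threshold \<open>N k\<close> has already been passed; each level is reached eventually, so the
  tolerance tends to 0.\<close>

lemma ex_diagonal_sequence:
  fixes f :: "real \<Rightarrow> nat \<Rightarrow> real"
  assumes lim: "\<And>\<delta>. 0 < \<delta> \<Longrightarrow> \<delta> < 1 \<Longrightarrow> f \<delta> \<longlonglongrightarrow> 0" and nonneg: "\<And>\<delta> n. f \<delta> n \<ge> 0"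
  shows "\<exists>\<delta>. \<delta> \<longlonglongrightarrow> 0 \<and> (\<forall>n. 0 < \<delta> n \<and> \<delta> n < 1) \<and> (\<lambda>n. f (\<delta> n) n) \<longlonglongrightarrow> 0"
proof -
  let ?d = "\<lambda>k. 1 / (real k + 2)"
  have "\<forall>k. \<exists>N. \<forall>n\<ge>N. f (?d k) n < ?d k"
  proof
    fix k
    have "\<forall>\<^sub>F n in sequentially. f (?d k) n < ?d k"
      by (intro order_tendstoD(2)[OF lim]) auto
    then show "\<exists>N. \<forall>n\<ge>N. f (?d k) n < ?d k" by (simp add: eventually_sequentially)
  qed
  then obtain N where N: "\<And>k n. n \<ge> N k \<Longrightarrow> f (?d k) n < ?d k" by metis
  \<comment> \<open>The default level 0 keeps \<open>S n\<close> nonempty before any threshold is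
    passed, and \<open>k \<le> n\<close> keeps it finite.\<close>
  define S where "S n = {k. k \<le> n \<and> (k = 0 \<or> N k \<le> n)}" for n
  define k where "k n = Max (S n)" for n
  have fin: "finite (S n)" "S n \<noteq> {}" for n by (auto simp: S_def)
  then have k_in: "k n \<in> S n" for n unfolding k_def by (rule Max_in)
  have k_large: "\<forall>\<^sub>F n in sequentially. K \<le> k n" for K
    using eventually_ge_at_top[of "max K (N K)"]
  proof eventually_elim
    case (elim n)
    then have "K \<in> S n" by (auto simp: S_def)
    then show ?case unfolding k_def using fin by simp
  qed
  then have k_lim: "filterlim k at_top sequentially"
    by (simp add: filterlim_at_top)
  have d: "(\<lambda>n. ?d (k n)) \<longlonglongrightarrow> 0"
  proof -
    have "?d \<longlonglongrightarrow> 0" by real_asymp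
    from filterlim_compose[OF this k_lim] show ?thesis .
  qed
  \<comment> \<open>Once \<open>k n\<close> is at least 1, it is no longer the default level, so its
    threshold has really been passed.\<close>
  have "\<forall>\<^sub>F n in sequentially. f (?d (k n)) n \<le> ?d (k n)"
    using k_large[of 1]
  proof eventually_elim
    case (elim n)
    then have "N (k n) \<le> n" using k_in[of n] by (auto simp: S_def)
    from N[OF this] show ?case by simp
  qed
  then have "(\<lambda>n. f (?d (k n)) n) \<longlonglongrightarrow> 0"
    using nonneg by (intro tendsto_sandwich[OF _ _ tendsto_const d]) auto
  with d show ?thesis by (intro exI[of _ "\<lambda>n. ?d (k n)"]) auto
qed

theorem lemma6p2:
  fixes \<beta> \<epsilon> :: real
  assumes "\<beta> > 0" and "0 < \<epsilon>" and "\<epsilon> < 1 / 2"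
  shows "\<exists>(\<delta> :: nat \<Rightarrow> real) (M :: nat \<Rightarrow> (graph \<times> graph \<times> graph) pmf).
    \<delta> \<longlonglongrightarrow> 0 \<and>
    (\<forall>n\<ge>1. \<bar>\<delta> n\<bar> < 1 \<and> bd_drgvr_coupling \<beta> \<epsilon> n (1 - \<delta> n) (1 + \<delta> n) (M n)) \<and>
    (\<lambda>n. measure_pmf.prob (M n) {(A, G, B). A \<subseteq>\<^sub>G G \<and> G \<subseteq>\<^sub>G B}) \<longlonglongrightarrow> 1"
proof -
  let ?F = "{(A, G, B). \<not> (A \<subseteq>\<^sub>G G \<and> G \<subseteq>\<^sub>G B)}"
  obtain \<delta> where \<delta>: "\<delta> \<longlonglongrightarrow> 0" "\<And>n. 0 < \<delta> n \<and> \<delta> n < 1"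
    and fail: "(\<lambda>n. measure_pmf.prob (coupling \<beta> \<epsilon> n (\<delta> n)) ?F) \<longlonglongrightarrow> 0"
    using ex_diagonal_sequence[of "\<lambda>\<delta> n. measure_pmf.prob (coupling \<beta> \<epsilon> n \<delta>) ?F"]
      coupling_failure_tendsto_0[OF assms] by auto
  have "{(A, G, B). A \<subseteq>\<^sub>G G \<and> G \<subseteq>\<^sub>G B} = UNIV - ?F" by auto
  then have "measure_pmf.prob M {(A, G, B). A \<subseteq>\<^sub>G G \<and> G \<subseteq>\<^sub>G B} = 1 - measure_pmf.prob M ?F" for M
    using measure_pmf.prob_compl[of ?F M] by simp
  moreover have "(\<lambda>n. 1 - measure_pmf.prob (coupling \<beta> \<epsilon> n (\<delta> n)) ?F) \<longlonglongrightarrow> 1"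
    using tendsto_diff[OF tendsto_const[of 1] fail] by simp
  moreover have "\<bar>\<delta> n\<bar> < 1" for n
    using \<delta>(2)[of n] by simp
  ultimately show ?thesis
    using \<delta>(1) assms(1)
    by (intro exI[of _ \<delta>] exI[of _ "\<lambda>n. coupling \<beta> \<epsilon> n (\<delta> n)"]) (simp add: bd_drgvr_coupling_coupling)
qed

end
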